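(* Let $\mathcal{C}$ be a left $H$-category. For $\mathcal M,\mathcal N\in (Mod\text{-}\mathcal C)_H$, the $H$-module action on $Hom_{Mod\text{-}\mathcal C}(\mathcal M,\mathcal N)$ given by $$(h\cdot \eta)(X)(m)=\sum h_1\,\eta (X)(S(h_2)m)$$ for $\eta\in Hom_{Mod\text{-}\mathcal C}(\mathcal M,\mathcal N)$, $h\in H$, $X\in Ob(\mathcal C)$, $m\in \mathcal M(X)$ makes $(Mod\text{-}\mathcal C)_H$ a left $H$-module category.
   Context: $K$ is a field and $H$ is a Hopf algebra over $K$ with comultiplication $\Delta(h)=\sum h_1\otimes h_2$, counit $\varepsilon$ and bijective antipode $S$. A left $H$-module category is a $K$-linear category $\mathcal A$ such that every $Hom_{\mathcal A}(X,Y)$ is a left $H$-module, $h(\mathrm{id}_X)=\varepsilon(h)\,\mathrm{id}_X$, and $h(fg)=\sum h_1(f)h_2(g)$ for all $h\in H$ and composable $g:X\to Y$, $f:Y\to Z$. A left $H$-category is a small left $H$-module category. A right $\mathcal C$-module is a $K$-linear functor $\mathcal C^{op}\to Vect_K$; these form the category $Mod\text{-}\mathcal C$. A left $H$-equivariant right $\mathcal C$-module is a right $\mathcal C$-module $\mathcal M$ with a left $H$-module structure on each $\mathcal M(X)$ such that $h(\mathcal M(f)(m))=\sum\mathcal M(h_2f)(h_1m)$ for all $h\in H$, $f\in Hom_{\mathcal C}(X,Y)$, $m\in\mathcal M(Y)$. $(Mod\text{-}\mathcal C)_H$ is the category whose objects are the left $H$-equivariant right $\mathcal C$-modules and whose morphisms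 are all morphisms of right $\mathcal C$-modules. *)

theory Defs
  imports "Jordan_Normal_Form.Missing_VectorSpace"
begin

section \<open>Tensor products of vector spaces\<close>

definition bilinear_maps ::
  "('k, 'z) ring_scheme \<Rightarrow> ('k, 'a, 'x) module_scheme \<Rightarrow> ('k, 'b, 'y) module_scheme \<Rightarrow>
   ('k, 'p, 'w) module_scheme \<Rightarrow> ('a \<Rightarrow> 'b \<Rightarrow> 'p) set" where
  "bilinear_maps K M N P = {F.
     (\<forall>a\<in>carrier M. F a \<in> module_hom K N P) \<and>
     (\<forall>b\<in>carrier N. (\<lambda>a. F a b) \<in> module_hom K M P)}"

text \<open>
  The list [(a1, b1), ..., (an, bn)] stands for the formal sum of the generators ai \<otimes> bi.
  The tensor product is the quotient of formal sums by the congruence generated by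
  commutativity and bilinearity; scalars and signs are absorbed into the entries. As formal
  sums have no subtraction, the zero relations are stated separately.
\<close>

inductive tensor_cong ::
  "('k, 'z) ring_scheme \<Rightarrow> ('k, 'a, 'x) module_scheme \<Rightarrow> ('k, 'b, 'y) module_scheme \<Rightarrow>
   ('a \<times> 'b) list \<Rightarrow> ('a \<times> 'b) list \<Rightarrow> bool"
  for K M N where
  refl: "xs \<in> lists (carrier M \<times> carrier N) \<Longrightarrow> tensor_cong K M N xs xs"
| sym: "tensor_cong K M N xs ys \<Longrightarrow> tensor_cong K M N ys xs"
| trans: "tensor_cong K M N xs ys \<Longrightarrow> tensor_cong K M N ys zs \<Longrightarrow> tensor_cong K M N xs zs"
| append: "tensor_cong K M N xs xs' \<Longrightarrow> tensor_cong K M N ys ys' \<Longrightarrow>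
    tensor_cong K M N (xs @ ys) (xs' @ ys')"
| commute: "xs \<in> lists (carrier M \<times> carrier N) \<Longrightarrow> ys \<in> lists (carrier M \<times> carrier N) \<Longrightarrow>
    tensor_cong K M N (xs @ ys) (ys @ xs)"
| add_left: "a \<in> carrier M \<Longrightarrow> a' \<in> carrier M \<Longrightarrow> b \<in> carrier N \<Longrightarrow>
    tensor_cong K M N [(a \<oplus>\<^bsub>M\<^esub> a', b)] [(a, b), (a', b)]"
| add_right: "a \<in> carrier M \<Longrightarrow> b \<in> carrier N \<Longrightarrow> b' \<in> carrier N \<Longrightarrow>
    tensor_cong K M N [(a, b \<oplus>\<^bsub>N\<^esub> b')] [(a, b), (a, b')]"
| scalar: "c \<in> carrier K \<Longrightarrow> a \<in> carrier M \<Longrightarrow> b \<in> carrier N \<Longrightarrow>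
    tensor_cong K M N [(c \<odot>\<^bsub>M\<^esub> a, b)] [(a, c \<odot>\<^bsub>N\<^esub> b)]"
| zero_left: "b \<in> carrier N \<Longrightarrow> tensor_cong K M N [(\<zero>\<^bsub>M\<^esub>, b)] []"
| zero_right: "a \<in> carrier M \<Longrightarrow> tensor_cong K M N [(a, \<zero>\<^bsub>N\<^esub>)] []"

definition tensor_class ::
  "('k, 'z) ring_scheme \<Rightarrow> ('k, 'a, 'x) module_scheme \<Rightarrow> ('k, 'b, 'y) module_scheme \<Rightarrow>
   ('a \<times> 'b) list \<Rightarrow> ('a \<times> 'b) list set" where
  "tensor_class K M N xs = {ys. tensor_cong K M N xs ys}"

definition tensor_rep :: "('a \<times> 'b) list set \<Rightarrow> ('a \<times> 'b) list" where
  "tensor_rep T = (SOME xs. xs \<in> T)"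

text \<open>
  The fields \<open>mult\<close> and \<open>one\<close> give the tensor product algebra; they are meaningful only
  if both factors are algebras.
\<close>

definition tensor ::
  "('k, 'z) ring_scheme \<Rightarrow> ('k, 'a, 'x) module_scheme \<Rightarrow> ('k, 'b, 'y) module_scheme \<Rightarrow>
   ('k, ('a \<times> 'b) list set) module" where
  "tensor K M N = \<lparr>
     carrier = tensor_class K M N ` lists (carrier M \<times> carrier N),
     mult = (\<lambda>T U. tensor_class K M N
       [(a \<otimes>\<^bsub>M\<^esub> c, b \<otimes>\<^bsub>N\<^esub> d). (a, b) \<leftarrow> tensor_rep T, (c, d) \<leftarrow> tensor_rep U]),
     one = tensor_class K M N [(\<one>\<^bsub>M\<^esub>, \<one>\<^bsub>N\<^esub>)],
     zero = tensor_class K M N [],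
     add = (\<lambda>T U. tensor_class K M N (tensor_rep T @ tensor_rep U)),
     smult = (\<lambda>c T. tensor_class K M N [(c \<odot>\<^bsub>M\<^esub> a, b). (a, b) \<leftarrow> tensor_rep T])\<rparr>"

definition pure_tensor ::
  "('k, 'z) ring_scheme \<Rightarrow> ('k, 'a, 'x) module_scheme \<Rightarrow> ('k, 'b, 'y) module_scheme \<Rightarrow>
   'a \<Rightarrow> 'b \<Rightarrow> ('a \<times> 'b) list set" where
  "pure_tensor K M N a b = tensor_class K M N [(a, b)]"

definition formal_sum :: "('p, 'w) ring_scheme \<Rightarrow> ('a \<Rightarrow> 'b \<Rightarrow> 'p) \<Rightarrow> ('a \<times> 'b) list \<Rightarrow> 'p" where
  "formal_sum P F xs = foldr (\<lambda>(a, b) s. F a b \<oplus>\<^bsub>P\<^esub> s) xs \<zero>\<^bsub>P\<^esub>"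

text \<open>
  The linear map on the tensor product induced by a bilinear map \<open>F\<close>, with values in \<open>P\<close>.
  It does not depend on the chosen representative (lemma \<open>tensor_lift_class\<close> below). With
  \<open>T\<close> the comultiplication of h, this is the Sweedler sum of \<open>F\<close> h1 h2 in \<open>P\<close>.
\<close>

definition tensor_lift ::
  "('p, 'w) ring_scheme \<Rightarrow> ('a \<Rightarrow> 'b \<Rightarrow> 'p) \<Rightarrow> ('a \<times> 'b) list set \<Rightarrow> 'p" where
  "tensor_lift P F T = formal_sum P F (tensor_rep T)"

definition tensor_map ::
  "('k, 'z) ring_scheme \<Rightarrow> ('k, 'c, 'x) module_scheme \<Rightarrow> ('k, 'd, 'y) module_scheme \<Rightarrow>
   ('a \<Rightarrow> 'c) \<Rightarrow> ('b \<Rightarrow> 'd) \<Rightarrow> ('a \<times> 'b) list set \<Rightarrow> ('c \<times> 'd) list set" where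
  "tensor_map K M N f g = tensor_lift (tensor K M N) (\<lambda>a b. pure_tensor K M N (f a) (g b))"

definition tensor_assoc ::
  "('k, 'z) ring_scheme \<Rightarrow> ('k, 'a, 'x) module_scheme \<Rightarrow> ('k, 'b, 'y) module_scheme \<Rightarrow>
   ('k, 'c, 'w) module_scheme \<Rightarrow>
   (('a \<times> 'b) list set \<times> 'c) list set \<Rightarrow> ('a \<times> ('b \<times> 'c) list set) list set" where
  "tensor_assoc K L M N =
     (let P = tensor K L (tensor K M N) in
      tensor_lift P (\<lambda>T c.
        tensor_lift P (\<lambda>a b. pure_tensor K L (tensor K M N) a (pure_tensor K M N b c)) T))"

lemma bilinear_mapsD:
  assumes "F \<in> bilinear_maps K M N P" "a \<in> carrier M" "b \<in> carrier N"
  shows "F a b \<in> carrier P"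
    and "a' \<in> carrier M \<Longrightarrow> F (a \<oplus>\<^bsub>M\<^esub> a') b = F a b \<oplus>\<^bsub>P\<^esub> F a' b"
    and "b' \<in> carrier N \<Longrightarrow> F a (b \<oplus>\<^bsub>N\<^esub> b') = F a b \<oplus>\<^bsub>P\<^esub> F a b'"
    and "c \<in> carrier K \<Longrightarrow> F (c \<odot>\<^bsub>M\<^esub> a) b = c \<odot>\<^bsub>P\<^esub> F a b"
    and "c \<in> carrier K \<Longrightarrow> F a (c \<odot>\<^bsub>N\<^esub> b) = c \<odot>\<^bsub>P\<^esub> F a b"
proof -
  have l: "(\<lambda>a. F a b) \<in> module_hom K M P" and r: "F a \<in> module_hom K N P"
    using assms unfolding bilinear_maps_def by blast+
  show "F a b \<in> carrier P" using module_hom_closed[OF r] assms(3) by blast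
  show "F (a \<oplus>\<^bsub>M\<^esub> a') b = F a b \<oplus>\<^bsub>P\<^esub> F a' b" if "a' \<in> carrier M"
    by (rule module_hom_add[OF l assms(2) that])
  show "F a (b \<oplus>\<^bsub>N\<^esub> b') = F a b \<oplus>\<^bsub>P\<^esub> F a b'" if "b' \<in> carrier N"
    by (rule module_hom_add[OF r assms(3) that])
  show "F (c \<odot>\<^bsub>M\<^esub> a) b = c \<odot>\<^bsub>P\<^esub> F a b" if "c \<in> carrier K"
    by (rule module_hom_smult[OF l that assms(2)])
  show "F a (c \<odot>\<^bsub>N\<^esub> b) = c \<odot>\<^bsub>P\<^esub> F a b" if "c \<in> carrier K"
    by (rule module_hom_smult[OF r that assms(3)])
qed

lemma tensor_cong_lists:
  assumes "module K M" "module K N" "tensor_cong K M N xs ys"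
  shows "xs \<in> lists (carrier M \<times> carrier N) \<and> ys \<in> lists (carrier M \<times> carrier N)"
  using assms(3)
proof induction
  case (add_left a a' b)
  then show ?case
    using abelian_monoid.a_closed abelian_group.axioms(1) module.axioms(2)[OF assms(1)]
    by (metis lists.Cons lists.Nil mem_Sigma_iff)
next
  case (add_right a b b')
  then show ?case
    using abelian_monoid.a_closed abelian_group.axioms(1) module.axioms(2)[OF assms(2)]
    by (metis lists.Cons lists.Nil mem_Sigma_iff)
qed (use assms(1,2) in \<open>auto simp: module.smult_closed
      abelian_monoid.zero_closed abelian_group.axioms(1) module.axioms(2)\<close>)

lemma formal_sum_cong:
  assumes M: "module K M" and N: "module K N" and P: "module K P"
    and F: "F \<in> bilinear_maps K M N P"
    and "tensor_cong K M N xs ys"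
  shows "formal_sum P F xs = formal_sum P F ys"
proof -
  interpret P: abelian_group P by (rule module.axioms(2)[OF P])
  note cl = bilinear_mapsD(1)[OF F]
  have nil: "formal_sum P F [] = \<zero>\<^bsub>P\<^esub>"
    and cons: "formal_sum P F ((a, b) # zs) = F a b \<oplus>\<^bsub>P\<^esub> formal_sum P F zs" for a b zs
    by (simp_all add: formal_sum_def)
  have fs: "formal_sum P F zs \<in> carrier P" if "zs \<in> lists (carrier M \<times> carrier N)" for zs
    using that
  proof (induction zs)
    case (Cons p zs)
    then show ?case using cl by (cases p) (simp add: cons)
  qed (simp add: nil)
  have app: "formal_sum P F (us @ vs) = formal_sum P F us \<oplus>\<^bsub>P\<^esub> formal_sum P F vs"
    if us: "us \<in> lists (carrier M \<times> carrier N)" and vs: "vs \<in> lists (carrier M \<times> carrier N)"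
    for us vs
    using us
  proof (induction us)
    case (Cons p us)
    then show ?case using cl fs[OF Cons.hyps(2)] fs[OF vs]
      by (cases p) (simp add: cons P.a_assoc)
  qed (simp add: nil fs[OF vs])
  have z0: "\<zero>\<^bsub>K\<^esub> \<in> carrier K"
    by (meson P cring.cring_simprules(2) module.axioms(1))
  show ?thesis using assms(5)
  proof induction
    case (append xs xs' ys ys')
    note l = tensor_cong_lists[OF M N append.hyps(1)] tensor_cong_lists[OF M N append.hyps(2)]
    show ?case using l append.IH by (simp add: app del: in_lists_conv_set)
  next
    case (commute xs ys)
    then show ?case
      using fs by (simp add: app P.a_comm del: in_lists_conv_set)
  next
    case (add_left a a' b)
    then show ?case
      by (simp add: cons nil cl bilinear_mapsD(2)[OF F])
  next
    case (add_right a b b')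
    then show ?case
      by (simp add: cons nil cl bilinear_mapsD(3)[OF F])
  next
    case (scalar c a b)
    then show ?case
      by (simp add: cons nil cl bilinear_mapsD(4,5)[OF F])
  next
    case (zero_left b)
    have z: "\<zero>\<^bsub>M\<^esub> \<in> carrier M"
      by (meson M abelian_group.axioms(1) abelian_monoid.zero_closed module.axioms(2))
    have "F \<zero>\<^bsub>M\<^esub> b = \<zero>\<^bsub>P\<^esub>"
      using bilinear_mapsD(4)[OF F z zero_left z0]
        module.smult_l_null[OF M z] module.smult_l_null[OF P cl[OF z zero_left]] by simp
    then show ?case by (simp add: cons nil)
  next
    case (zero_right a)
    have z: "\<zero>\<^bsub>N\<^esub> \<in> carrier N"
      by (meson N abelian_group.axioms(1) abelian_monoid.zero_closed module.axioms(2))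
    have "F a \<zero>\<^bsub>N\<^esub> = \<zero>\<^bsub>P\<^esub>"
      using bilinear_mapsD(5)[OF F zero_right z z0]
        module.smult_l_null[OF N z] module.smult_l_null[OF P cl[OF zero_right z]] by simp
    then show ?case by (simp add: cons nil)
  qed simp_all
qed

lemma tensor_lift_class:
  assumes "module K M" "module K N" "module K P" "F \<in> bilinear_maps K M N P"
    and xs: "xs \<in> lists (carrier M \<times> carrier N)"
  shows "tensor_lift P F (tensor_class K M N xs) = formal_sum P F xs"
proof -
  have "xs \<in> tensor_class K M N xs"
    using tensor_cong.refl[OF xs] unfolding tensor_class_def by blast
  then have "tensor_rep (tensor_class K M N xs) \<in> tensor_class K M N xs"
    unfolding tensor_rep_def by (rule someI)
  then have "tensor_cong K M N xs (tensor_rep (tensor_class K M N xs))"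
    unfolding tensor_class_def by blast
  from formal_sum_cong[OF assms(1-4) this] show ?thesis
    unfolding tensor_lift_def by (rule HOL.sym)
qed


section \<open>Hopf algebras and their modules\<close>

record ('k, 'h) hopf = "('k, 'h) module" +
  comult :: "'h \<Rightarrow> ('h \<times> 'h) list set"
  counit :: "'h \<Rightarrow> 'k"
  antipode :: "'h \<Rightarrow> 'h"

locale hopf_algebra = vectorspace K H + H?: ring H
  for K :: "('k, 'z) ring_scheme" and H :: "('k, 'h) hopf" +
  assumes mult_bilinear: "mult H \<in> bilinear_maps K H H H"
    and comult_linear: "comult H \<in> module_hom K H (tensor K H H)"
    and comult_ring_hom: "comult H \<in> ring_hom H (tensor K H H)"
    and counit_ring_hom: "counit H \<in> ring_hom H K"
    and counit_smult: "c \<in> carrier K \<Longrightarrow> h \<in> carrier H \<Longrightarrow>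
      counit H (c \<odot>\<^bsub>H\<^esub> h) = c \<otimes>\<^bsub>K\<^esub> counit H h"
    and coassoc: "h \<in> carrier H \<Longrightarrow>
      tensor_assoc K H H H (tensor_map K (tensor K H H) H (comult H) id (comult H h))
        = tensor_map K H (tensor K H H) id (comult H) (comult H h)"
    and counit_left: "h \<in> carrier H \<Longrightarrow>
      tensor_lift H (\<lambda>a b. counit H a \<odot>\<^bsub>H\<^esub> b) (comult H h) = h"
    and counit_right: "h \<in> carrier H \<Longrightarrow>
      tensor_lift H (\<lambda>a b. counit H b \<odot>\<^bsub>H\<^esub> a) (comult H h) = h"
    and antipode_linear: "antipode H \<in> module_hom K H H"
    and antipode_left: "h \<in> carrier H \<Longrightarrow>
      tensor_lift H (\<lambda>a b. antipode H a \<otimes>\<^bsub>H\<^esub> b) (comult H h) = counit H h \<odot>\<^bsub>H\<^esub> \<one>\<^bsub>H\<^esub>"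
    and antipode_right: "h \<in> carrier H \<Longrightarrow>
      tensor_lift H (\<lambda>a b. a \<otimes>\<^bsub>H\<^esub> antipode H b) (comult H h) = counit H h \<odot>\<^bsub>H\<^esub> \<one>\<^bsub>H\<^esub>"

text \<open>
  An \<open>H\<close>-module structure on a given \<open>K\<close>-vector space \<open>V\<close>. Bilinearity says in particular that
  \<open>K\<close> acts through \<open>H\<close> by the given scalar multiplication of \<open>V\<close>.
\<close>

locale left_H_module = hopf_algebra K H + V: vectorspace K V
  for K :: "('k, 'z) ring_scheme" and H :: "('k, 'h) hopf" and V :: "('k, 'v) module" +
  fixes act :: "'h \<Rightarrow> 'v \<Rightarrow> 'v"
  assumes act_bilinear: "act \<in> bilinear_maps K H V V"
    and act_one: "v \<in> carrier V \<Longrightarrow> act \<one>\<^bsub>H\<^esub> v = v"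
    and act_mult: "a \<in> carrier H \<Longrightarrow> b \<in> carrier H \<Longrightarrow> v \<in> carrier V \<Longrightarrow>
      act (a \<otimes>\<^bsub>H\<^esub> b) v = act a (act b v)"


section \<open>Linear categories and \<open>H\<close>-module categories\<close>

text \<open>
  Morphism spaces are vector spaces; the fields \<open>mult\<close> and \<open>one\<close> of their records are unused.
  They need not be disjoint, so composition takes the objects as arguments:
  \<open>Comp C X Y Z f g\<close> is the composite of \<open>g\<close> from \<open>X\<close> to \<open>Y\<close> with \<open>f\<close> from \<open>Y\<close> to \<open>Z\<close>.
\<close>

record ('o, 'm, 'k) lincat =
  Obj :: "'o set"
  Hom :: "'o \<Rightarrow> 'o \<Rightarrow> ('k, 'm) module"
  Comp :: "'o \<Rightarrow> 'o \<Rightarrow> 'o \<Rightarrow> 'm \<Rightarrow> 'm \<Rightarrow> 'm"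
  Id :: "'o \<Rightarrow> 'm"

locale linear_category = field K
  for K :: "('k, 'z) ring_scheme" +
  fixes C :: "('o, 'm, 'k) lincat"
  assumes Hom_vectorspace: "X \<in> Obj C \<Longrightarrow> Y \<in> Obj C \<Longrightarrow> vectorspace K (Hom C X Y)"
    and Comp_bilinear: "X \<in> Obj C \<Longrightarrow> Y \<in> Obj C \<Longrightarrow> Z \<in> Obj C \<Longrightarrow>
      Comp C X Y Z \<in> bilinear_maps K (Hom C Y Z) (Hom C X Y) (Hom C X Z)"
    and Comp_assoc: "W \<in> Obj C \<Longrightarrow> X \<in> Obj C \<Longrightarrow> Y \<in> Obj C \<Longrightarrow> Z \<in> Obj C \<Longrightarrow>
      f \<in> carrier (Hom C Y Z) \<Longrightarrow> g \<in> carrier (Hom C X Y) \<Longrightarrow> h \<in> carrier (Hom C W X) \<Longrightarrow>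
      Comp C W X Z (Comp C X Y Z f g) h = Comp C W Y Z f (Comp C W X Y g h)"
    and Id_closed: "X \<in> Obj C \<Longrightarrow> Id C X \<in> carrier (Hom C X X)"
    and Id_left: "X \<in> Obj C \<Longrightarrow> Y \<in> Obj C \<Longrightarrow> f \<in> carrier (Hom C X Y) \<Longrightarrow>
      Comp C X Y Y (Id C Y) f = f"
    and Id_right: "X \<in> Obj C \<Longrightarrow> Y \<in> Obj C \<Longrightarrow> f \<in> carrier (Hom C X Y) \<Longrightarrow>
      Comp C X X Y f (Id C X) = f"

locale left_H_module_category = hopf_algebra K H + linear_category K A
  for K :: "('k, 'z) ring_scheme" and H :: "('k, 'h) hopf" and A :: "('o, 'm, 'k) lincat" +
  fixes act :: "'o \<Rightarrow> 'o \<Rightarrow> 'h \<Rightarrow> 'm \<Rightarrow> 'm"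
  assumes Hom_H_module: "X \<in> Obj A \<Longrightarrow> Y \<in> Obj A \<Longrightarrow>
      left_H_module K H (Hom A X Y) (act X Y)"
    and act_Id: "X \<in> Obj A \<Longrightarrow> h \<in> carrier H \<Longrightarrow>
      act X X h (Id A X) = counit H h \<odot>\<^bsub>Hom A X X\<^esub> Id A X"
    and act_Comp: "X \<in> Obj A \<Longrightarrow> Y \<in> Obj A \<Longrightarrow> Z \<in> Obj A \<Longrightarrow> h \<in> carrier H \<Longrightarrow>
      f \<in> carrier (Hom A Y Z) \<Longrightarrow> g \<in> carrier (Hom A X Y) \<Longrightarrow>
      act X Z h (Comp A X Y Z f g) =
        tensor_lift (Hom A X Z) (\<lambda>a b. Comp A X Y Z (act Y Z a f) (act X Y b g)) (comult H h)"

text \<open>Smallness is automatic: the objects form a set.\<close>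

locale left_H_category = left_H_module_category


section \<open>Equivariant right modules\<close>

text \<open>
  A right \<open>C\<close>-module: \<open>mod_map M X Y f\<close> is the map from \<open>M(Y)\<close> to \<open>M(X)\<close> assigned to \<open>f\<close>
  from \<open>X\<close> to \<open>Y\<close>.
\<close>

record ('o, 'm, 'k, 'v) rmod =
  mod_at :: "'o \<Rightarrow> ('k, 'v) module"
  mod_map :: "'o \<Rightarrow> 'o \<Rightarrow> 'm \<Rightarrow> 'v \<Rightarrow> 'v"

record ('o, 'm, 'k, 'v, 'h) eqrmod = "('o, 'm, 'k, 'v) rmod" +
  mod_act :: "'o \<Rightarrow> 'h \<Rightarrow> 'v \<Rightarrow> 'v"

locale right_module = linear_category K C
  for K :: "('k, 'z) ring_scheme" and C :: "('o, 'm, 'k) lincat" +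
  fixes M :: "('o, 'm, 'k, 'v, 'y) rmod_scheme"
  assumes mod_vectorspace: "X \<in> Obj C \<Longrightarrow> vectorspace K (mod_at M X)"
    and mod_map_bilinear: "X \<in> Obj C \<Longrightarrow> Y \<in> Obj C \<Longrightarrow>
      mod_map M X Y \<in> bilinear_maps K (Hom C X Y) (mod_at M Y) (mod_at M X)"
    and mod_map_Id: "X \<in> Obj C \<Longrightarrow> m \<in> carrier (mod_at M X) \<Longrightarrow>
      mod_map M X X (Id C X) m = m"
    and mod_map_Comp: "X \<in> Obj C \<Longrightarrow> Y \<in> Obj C \<Longrightarrow> Z \<in> Obj C \<Longrightarrow>
      f \<in> carrier (Hom C Y Z) \<Longrightarrow> g \<in> carrier (Hom C X Y) \<Longrightarrow> m \<in> carrier (mod_at M Z) \<Longrightarrow>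
      mod_map M X Z (Comp C X Y Z f g) m = mod_map M X Y g (mod_map M Y Z f m)"

locale equivariant_right_module =
  left_H_category K H C act + right_module K C M
  for K :: "('k, 'z) ring_scheme" and H :: "('k, 'h) hopf" and C :: "('o, 'm, 'k) lincat"
    and act :: "'o \<Rightarrow> 'o \<Rightarrow> 'h \<Rightarrow> 'm \<Rightarrow> 'm" and M :: "('o, 'm, 'k, 'v, 'h) eqrmod" +
  assumes mod_H_module: "X \<in> Obj C \<Longrightarrow> left_H_module K H (mod_at M X) (mod_act M X)"
    and equivariant: "X \<in> Obj C \<Longrightarrow> Y \<in> Obj C \<Longrightarrow> h \<in> carrier H \<Longrightarrow>
      f \<in> carrier (Hom C X Y) \<Longrightarrow> m \<in> carrier (mod_at M Y) \<Longrightarrow>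
      mod_act M X h (mod_map M X Y f m) =
        tensor_lift (mod_at M X) (\<lambda>a b. mod_map M X Y (act X Y b f) (mod_act M Y a m))
          (comult H h)"

text \<open>
  Morphisms of right modules are families of linear maps, taken to be \<open>undefined\<close> outside the
  objects and carriers so that equal morphisms are equal functions.
\<close>

definition nat_family ::
  "('o, 'm, 'k) lincat \<Rightarrow> ('o, 'm, 'k, 'v, 'y) rmod_scheme \<Rightarrow> ('o \<Rightarrow> 'v \<Rightarrow> 'v) \<Rightarrow> 'o \<Rightarrow> 'v \<Rightarrow> 'v" where
  "nat_family C M \<eta> = (\<lambda>X\<in>Obj C. \<lambda>m\<in>carrier (mod_at M X). \<eta> X m)"

definition rmod_hom ::
  "('k, 'z) ring_scheme \<Rightarrow> ('o, 'm, 'k) lincat \<Rightarrow> ('o, 'm, 'k, 'v, 'y) rmod_scheme \<Rightarrow>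
   ('o, 'm, 'k, 'v, 'y) rmod_scheme \<Rightarrow> ('k, 'o \<Rightarrow> 'v \<Rightarrow> 'v) module" where
  "rmod_hom K C M N = \<lparr>
     carrier = {\<eta> \<in> extensional (Obj C).
       (\<forall>X\<in>Obj C. \<eta> X \<in> module_hom K (mod_at M X) (mod_at N X) \<inter> extensional (carrier (mod_at M X))) \<and>
       (\<forall>X\<in>Obj C. \<forall>Y\<in>Obj C. \<forall>f\<in>carrier (Hom C X Y). \<forall>m\<in>carrier (mod_at M Y).
          \<eta> X (mod_map M X Y f m) = mod_map N X Y f (\<eta> Y m))},
     mult = undefined,
     one = undefined,
     zero = nat_family C M (\<lambda>X m. \<zero>\<^bsub>mod_at N X\<^esub>),
     add = (\<lambda>\<eta> \<theta>. nat_family C M (\<lambda>X m. \<eta> X m \<oplus>\<^bsub>mod_at N X\<^esub> \<theta> X m)),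
     smult = (\<lambda>c \<eta>. nat_family C M (\<lambda>X m. c \<odot>\<^bsub>mod_at N X\<^esub> \<eta> X m))\<rparr>"

text \<open>
  The category of equivariant right modules whose values have their elements in the type \<open>'v\<close>.
\<close>

definition equivariant_modules ::
  "('k, 'z) ring_scheme \<Rightarrow> ('k, 'h) hopf \<Rightarrow> ('o, 'm, 'k) lincat \<Rightarrow> ('o \<Rightarrow> 'o \<Rightarrow> 'h \<Rightarrow> 'm \<Rightarrow> 'm) \<Rightarrow>
   (('o, 'm, 'k, 'v, 'h) eqrmod, 'o \<Rightarrow> 'v \<Rightarrow> 'v, 'k) lincat" where
  "equivariant_modules K H C act = \<lparr>
     Obj = {M. equivariant_right_module K H C act M},
     Hom = rmod_hom K C,
     Comp = (\<lambda>L M N \<eta> \<theta>. nat_family C L (\<lambda>X m. \<eta> X (\<theta> X m))),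
     Id = (\<lambda>M. nat_family C M (\<lambda>X m. m))\<rparr>"

definition rmod_hom_act ::
  "('k, 'h) hopf \<Rightarrow> ('o, 'm, 'k) lincat \<Rightarrow> ('o, 'm, 'k, 'v, 'h) eqrmod \<Rightarrow>
   ('o, 'm, 'k, 'v, 'h) eqrmod \<Rightarrow> 'h \<Rightarrow> ('o \<Rightarrow> 'v \<Rightarrow> 'v) \<Rightarrow> 'o \<Rightarrow> 'v \<Rightarrow> 'v" where
  "rmod_hom_act H C M N h \<eta> = nat_family C M (\<lambda>X m.
     tensor_lift (mod_at N X) (\<lambda>a b. mod_act N X a (\<eta> X (mod_act M X (antipode H b) m)))
       (comult H h))"

end

theory Submission
  imports Defs
begin

text \<open>
  In Sweedler notation every axiom is a short computation. The action of \<open>g h\<close> is the composite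
  of the actions because \<open>S(g h) = S(h) S(g)\<close>. Compatibility with composition,
  \<open>h1 \<eta>(S(h2) h3 \<theta>(S(h4) m)) = h1 \<eta>(\<theta>(S(h2) m))\<close>, cancels the two middle factors. The same
  cancellation, now of \<open>h2 S(h3)\<close>, shows that \<open>h \<eta>\<close> is again natural:
  \<open>h1 \<eta>(S(h2) M(f)(m)) = h1 \<eta>(M(S(h2) f)(S(h3) m)) = N(h2 S(h3) f)(h1 \<eta>(S(h4) m))\<close>.
  These computations are legitimate because linear maps commute with Sweedler sums and because a
  map that is linear in each of three variables factors through both triple tensor products that
  coassociativity identifies.
\<close>


section \<open>Linear maps and formal sums\<close>

text \<open>The obstacle is that \<open>comult H h\<close> is a class of formal sums, of which
  \<open>tensor_lift\<close> adds up one representative obtained by choice. For fixed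
  \<open>h\<close> a Sweedler sum is therefore an ordinary finite sum along one list: termwise
  rewriting, exchange with linear maps and exchange of two independent sums ask only for summands in
  the carrier. The laws that change the comultiplied element or regroup its legs, such as linearity
  in \<open>h\<close>, the product rule and coassociativity, compare different representatives and
  need multilinear summands. Most side conditions below are proofs of such linearity. The reversal
  of products by the antipode is not an axiom either; it comes from uniqueness of inverses under
  convolution, an argument that returns for equivariant modules.\<close>

lemma module_homI:
  assumes "\<And>x. x \<in> carrier M \<Longrightarrow> f x \<in> carrier N"
    and "\<And>x y. x \<in> carrier M \<Longrightarrow> y \<in> carrier M \<Longrightarrow> f (x \<oplus>\<^bsub>M\<^esub> y) = f x \<oplus>\<^bsub>N\<^esub> f y"
    and "\<And>c x. c \<in> carrier K \<Longrightarrow> x \<in> carrier M \<Longrightarrow> f (c \<odot>\<^bsub>M\<^esub> x) = c \<odot>\<^bsub>N\<^esub> f x"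
  shows "f \<in> module_hom K M N"
  using assms unfolding module_hom_def by auto

lemma module_hom_mem: "f \<in> module_hom K M N \<Longrightarrow> x \<in> carrier M \<Longrightarrow> f x \<in> carrier N"
  using module_hom_closed by blast

lemma module_hom_ident: "(\<lambda>x. x) \<in> module_hom K M M"
  by (rule module_homI) simp_all

lemma module_hom_comp:
  assumes "g \<in> module_hom K N P" "f \<in> module_hom K M N"
  shows "(\<lambda>x. g (f x)) \<in> module_hom K M P"
  by (rule module_homI)
    (simp_all add: module_hom_mem[OF assms(1)] module_hom_mem[OF assms(2)]
      module_hom_add[OF assms(1)] module_hom_add[OF assms(2)]
      module_hom_smult[OF assms(1)] module_hom_smult[OF assms(2)])

lemma module_hom_zero:
  assumes "module K M" "module K N" "f \<in> module_hom K M N"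
  shows "f \<zero>\<^bsub>M\<^esub> = \<zero>\<^bsub>N\<^esub>"
proof -
  interpret mod_hom K M N f
    using assms by (intro mod_hom.intro mod_hom_axioms.intro)
  show ?thesis by simp
qed

text \<open>Membership in \<open>module_hom\<close> depends only on values on the carrier, so a
  function may be changed off it. This covers the restrictions made by
  \<open>nat_family\<close>.\<close>

lemma module_hom_cong:
  assumes "f \<in> module_hom K M N" "\<And>x. x \<in> carrier M \<Longrightarrow> g x = f x" "module K M"
  shows "g \<in> module_hom K M N"
proof -
  interpret module K M by fact
  show ?thesis
    by (rule module_homI)
      (simp_all add: assms(2) module_hom_mem[OF assms(1)] module_hom_add[OF assms(1)]
        module_hom_smult[OF assms(1)])
qed

lemma bilinear_mapsI:
  assumes "\<And>b. b \<in> carrier N \<Longrightarrow> (\<lambda>a. F a b) \<in> module_hom K M P"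
    and "\<And>a. a \<in> carrier M \<Longrightarrow> (\<lambda>b. F a b) \<in> module_hom K N P"
  shows "F \<in> bilinear_maps K M N P"
  using assms unfolding bilinear_maps_def by auto

lemma bilinear_maps_left:
  assumes "F \<in> bilinear_maps K M N P" "f \<in> module_hom K L M" "b \<in> carrier N"
  shows "(\<lambda>x. F (f x) b) \<in> module_hom K L P"
proof -
  have "(\<lambda>a. F a b) \<in> module_hom K M P"
    using assms(1,3) unfolding bilinear_maps_def by blast
  from module_hom_comp[OF this assms(2)] show ?thesis .
qed

lemma bilinear_maps_right:
  assumes "F \<in> bilinear_maps K M N P" "f \<in> module_hom K L N" "a \<in> carrier M"
  shows "(\<lambda>x. F a (f x)) \<in> module_hom K L P"
proof -
  have "F a \<in> module_hom K N P"
    using assms(1,3) unfolding bilinear_maps_def by blast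
  from module_hom_comp[OF this assms(2)] show ?thesis .
qed

section \<open>Sums over lists of pairs\<close>

lemma formal_sum_Nil [simp]: "formal_sum P F [] = \<zero>\<^bsub>P\<^esub>"
  and formal_sum_Cons [simp]: "formal_sum P F ((a, b) # xs) = F a b \<oplus>\<^bsub>P\<^esub> formal_sum P F xs"
  by (simp_all add: formal_sum_def)

lemma formal_sum_cong_fun:
  assumes "xs \<in> lists (A \<times> B)" "\<And>a b. a \<in> A \<Longrightarrow> b \<in> B \<Longrightarrow> F a b = G a b"
  shows "formal_sum P F xs = formal_sum P G xs"
  using assms(1) by induction (auto simp: assms(2))

text \<open>Both claims come from one induction, because additivity of \<open>f\<close> on head and
  tail needs the tail sum to lie in the carrier.\<close>

lemma formal_sum_module_hom:
  assumes "module K P" "module K Q" "f \<in> module_hom K P Q" "xs \<in> lists (A \<times> B)"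
    and "\<And>a b. a \<in> A \<Longrightarrow> b \<in> B \<Longrightarrow> F a b \<in> carrier P"
  shows "formal_sum P F xs \<in> carrier P \<and>
    f (formal_sum P F xs) = formal_sum Q (\<lambda>a b. f (F a b)) xs"
proof -
  interpret P: module K P by fact
  show ?thesis
    using assms(4)
    by induction
      (auto simp: assms(5) module_hom_zero[OF assms(1-3)] module_hom_add[OF assms(3)])
qed

context module
begin

lemma formal_sum_closed:
  assumes "xs \<in> lists (A \<times> B)" "\<And>a b. a \<in> A \<Longrightarrow> b \<in> B \<Longrightarrow> F a b \<in> carrier M"
  shows "formal_sum M F xs \<in> carrier M"
  using assms(1) by induction (auto simp: assms(2))

lemma formal_sum_append:
  assumes "xs \<in> lists (A \<times> B)" "ys \<in> lists (A \<times> B)"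
    and "\<And>a b. a \<in> A \<Longrightarrow> b \<in> B \<Longrightarrow> F a b \<in> carrier M"
  shows "formal_sum M F (xs @ ys) = formal_sum M F xs \<oplus>\<^bsub>M\<^esub> formal_sum M F ys"
  using assms(1)
proof induction
  case Nil
  then show ?case using formal_sum_closed[OF assms(2,3)] by simp
next
  case (Cons p xs)
  then show ?case
    using formal_sum_closed[OF assms(2,3)] formal_sum_closed[OF Cons(2) assms(3)]
    by (cases p) (auto simp: assms(3) M.a_assoc)
qed

lemma formal_sum_zero: "formal_sum M (\<lambda>a b. \<zero>\<^bsub>M\<^esub>) xs = \<zero>\<^bsub>M\<^esub>"
  by (induction xs) auto

lemma formal_sum_add:
  assumes "xs \<in> lists (A \<times> B)" "\<And>a b. a \<in> A \<Longrightarrow> b \<in> B \<Longrightarrow> F a b \<in> carrier M"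
    and "\<And>a b. a \<in> A \<Longrightarrow> b \<in> B \<Longrightarrow> G a b \<in> carrier M"
  shows "formal_sum M (\<lambda>a b. F a b \<oplus>\<^bsub>M\<^esub> G a b) xs = formal_sum M F xs \<oplus>\<^bsub>M\<^esub> formal_sum M G xs"
  using assms(1)
proof induction
  case (Cons p xs)
  then show ?case
    using formal_sum_closed[OF Cons(2) assms(2)] formal_sum_closed[OF Cons(2) assms(3)]
    by (cases p) (auto simp: assms(2,3) M.a_ac)
qed simp

lemma formal_sum_smult:
  assumes "xs \<in> lists (A \<times> B)" "\<And>a b. a \<in> A \<Longrightarrow> b \<in> B \<Longrightarrow> F a b \<in> carrier M"
    and "c \<in> carrier R"
  shows "formal_sum M (\<lambda>a b. c \<odot>\<^bsub>M\<^esub> F a b) xs = c \<odot>\<^bsub>M\<^esub> formal_sum M F xs"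
  using assms(1)
proof induction
  case (Cons p xs)
  then show ?case
    using formal_sum_closed[OF Cons(2) assms(2)]
    by (cases p) (auto simp: assms(2,3) smult_r_distr)
qed (simp add: assms(3))

lemma formal_sum_swap:
  assumes "xs \<in> lists (A \<times> B)" "ys \<in> lists (A' \<times> B')"
    and F: "\<And>a b c d. a \<in> A \<Longrightarrow> b \<in> B \<Longrightarrow> c \<in> A' \<Longrightarrow> d \<in> B' \<Longrightarrow> F a b c d \<in> carrier M"
  shows "formal_sum M (\<lambda>a b. formal_sum M (\<lambda>c d. F a b c d) ys) xs =
    formal_sum M (\<lambda>c d. formal_sum M (\<lambda>a b. F a b c d) xs) ys"
  using assms(1)
proof induction
  case Nil
  then show ?case by (simp add: formal_sum_zero)
next
  case (Cons p xs)
  obtain a b where p: "p = (a, b)" "a \<in> A" "b \<in> B" using Cons by auto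
  have "formal_sum M (\<lambda>c d. F a b c d \<oplus>\<^bsub>M\<^esub> formal_sum M (\<lambda>a b. F a b c d) xs) ys =
    formal_sum M (\<lambda>c d. F a b c d) ys \<oplus>\<^bsub>M\<^esub>
    formal_sum M (\<lambda>c d. formal_sum M (\<lambda>a b. F a b c d) xs) ys"
    by (rule formal_sum_add[OF assms(2)]) (use p F formal_sum_closed[OF Cons(2)] in auto)
  then show ?case using Cons p by simp
qed

text \<open>The list is the one by which \<open>tensor\<close> multiplies two classes, with
  \<open>f\<close> and \<open>g\<close> the products of the two factors. It turns multiplicativity
  of the comultiplication into a double sum.\<close>

lemma formal_sum_product:
  assumes "xs \<in> lists (A \<times> B)" "ys \<in> lists (A' \<times> B')"
    and "\<And>a b c d. a \<in> A \<Longrightarrow> b \<in> B \<Longrightarrow> c \<in> A' \<Longrightarrow> d \<in> B' \<Longrightarrow> f a c \<in> A'' \<and> g b d \<in> B''"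
    and "\<And>a b. a \<in> A'' \<Longrightarrow> b \<in> B'' \<Longrightarrow> F a b \<in> carrier M"
  shows "formal_sum M F [(f a c, g b d). (a, b) \<leftarrow> xs, (c, d) \<leftarrow> ys] =
    formal_sum M (\<lambda>a b. formal_sum M (\<lambda>c d. F (f a c) (g b d)) ys) xs"
  using assms(1)
proof induction
  case (Cons p xs)
  obtain a b where p: "p = (a, b)" "a \<in> A" "b \<in> B" using Cons by auto
  have "formal_sum M F (map (\<lambda>(c, d). (f a c, g b d)) zs) = formal_sum M (\<lambda>c d. F (f a c) (g b d)) zs"
    for zs by (induction zs) auto
  moreover have "map (\<lambda>(c, d). (f a c, g b d)) ys \<in> lists (A'' \<times> B'')"
    using p assms(2,3) by fastforce
  moreover have "[(f a c, g b d). (a, b) \<leftarrow> xs, (c, d) \<leftarrow> ys] \<in> lists (A'' \<times> B'')"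
    using Cons(2) assms(2,3) by fastforce
  ultimately show ?case
    using Cons(3) by (simp add: p formal_sum_append[OF _ _ assms(4)])
qed simp

end


section \<open>The tensor product of modules\<close>

locale tensor_modules = M: module K M + N: module K N
  for K :: "('k, 'z) ring_scheme" and M :: "('k, 'a, 'x) module_scheme"
    and N :: "('k, 'b, 'y) module_scheme"
begin

abbreviation cong (infix \<open>\<approx>\<close> 50) where "cong \<equiv> tensor_cong K M N"
abbreviation sums where "sums \<equiv> lists (carrier M \<times> carrier N)"
abbreviation cls where "cls \<equiv> tensor_class K M N"
abbreviation scale where "scale c \<equiv> map (\<lambda>(a, b). (c \<odot>\<^bsub>M\<^esub> a, b))"

section \<open>Congruence of formal sums and the operations on classes\<close>

lemma cong_sums: "xs \<approx> ys \<Longrightarrow> xs \<in> sums \<and> ys \<in> sums"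
  by (rule tensor_cong_lists[OF M.module_axioms N.module_axioms])

lemma cls_eqI: "xs \<approx> ys \<Longrightarrow> cls xs = cls ys"
  unfolding tensor_class_def by (blast intro: tensor_cong.sym tensor_cong.trans)

text \<open>The representative is a choice, so congruence is all that can be known about it; the
  operations of \<open>tensor\<close> are controlled through this fact.\<close>

lemma rep_cls: "xs \<in> sums \<Longrightarrow> tensor_rep (cls xs) \<approx> xs"
  unfolding tensor_rep_def
  by (rule someI2[of "\<lambda>ys. ys \<in> cls xs" xs])
    (auto simp: tensor_class_def simp del: in_lists_conv_set intro: tensor_cong.refl tensor_cong.sym)

lemma carrier_tensorE:
  assumes "T \<in> carrier (tensor K M N)"
  obtains xs where "xs \<in> sums" "T = cls xs"
  using assms unfolding tensor_def by auto

lemma cls_closed: "xs \<in> sums \<Longrightarrow> cls xs \<in> carrier (tensor K M N)"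
  unfolding tensor_def by simp

lemma rep_in_sums: "T \<in> carrier (tensor K M N) \<Longrightarrow> tensor_rep T \<in> sums"
  by (erule carrier_tensorE) (use rep_cls cong_sums in blast)

lemma add_cls:
  assumes "xs \<in> sums" "ys \<in> sums"
  shows "cls xs \<oplus>\<^bsub>tensor K M N\<^esub> cls ys = cls (xs @ ys)"
  unfolding tensor_def using tensor_cong.append[OF rep_cls rep_cls, OF assms] by (simp add: cls_eqI)

lemma scale_in_sums: "c \<in> carrier K \<Longrightarrow> xs \<in> sums \<Longrightarrow> scale c xs \<in> sums"
  by fastforce

text \<open>Scaling acts linearly on first entries and so respects the generating relations; only
  the relation \<open>scalar\<close> needs two scalars to commute. This makes \<open>smult\<close>
  of \<open>tensor\<close> independent of the representative.\<close>

lemma scale_cong: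
  assumes c: "c \<in> carrier K" and "xs \<approx> ys"
  shows "scale c xs \<approx> scale c ys"
  using assms(2)
proof induction
  case (refl xs)
  show ?case by (rule tensor_cong.refl[OF scale_in_sums[OF c refl]])
next
  case (commute xs ys)
  show ?case
    using tensor_cong.commute[OF scale_in_sums[OF c commute(1)] scale_in_sums[OF c commute(2)]]
    by simp
next
  case (add_left a a' b)
  then show ?case
    using c tensor_cong.add_left[of "c \<odot>\<^bsub>M\<^esub> a" M "c \<odot>\<^bsub>M\<^esub> a'" b N] by (simp add: M.smult_r_distr)
next
  case (add_right a b b')
  then show ?case using c tensor_cong.add_right[of "c \<odot>\<^bsub>M\<^esub> a" M b N b'] by simp
next
  case (scalar d a b)
  have "c \<odot>\<^bsub>M\<^esub> (d \<odot>\<^bsub>M\<^esub> a) = d \<odot>\<^bsub>M\<^esub> (c \<odot>\<^bsub>M\<^esub> a)"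
    using c scalar by (simp add: M.smult_assoc1[symmetric] M.m_comm)
  then show ?case using c scalar tensor_cong.scalar[of d K "c \<odot>\<^bsub>M\<^esub> a" M b N] by simp
next
  case (zero_left b)
  then show ?case using c tensor_cong.zero_left[of b N K M] by simp
next
  case (zero_right a)
  then show ?case using c tensor_cong.zero_right[of "c \<odot>\<^bsub>M\<^esub> a" M K N] by simp
qed (use tensor_cong.sym tensor_cong.trans tensor_cong.append in \<open>auto simp: c\<close>)

lemma smult_cls:
  assumes "c \<in> carrier K" "xs \<in> sums"
  shows "c \<odot>\<^bsub>tensor K M N\<^esub> cls xs = cls (scale c xs)"
  unfolding tensor_def using scale_cong[OF assms(1) rep_cls[OF assms(2)]]
  by (simp add: cls_eqI case_prod_beta')

lemma cls_zero: "\<zero>\<^bsub>tensor K M N\<^esub> = cls []"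
  unfolding tensor_def by simp

section \<open>The tensor product as a module\<close>

lemma Cons_cls:
  assumes "a \<in> carrier M" "b \<in> carrier N" "xs \<in> sums"
  shows "cls ((a, b) # xs) = pure_tensor K M N a b \<oplus>\<^bsub>tensor K M N\<^esub> cls xs"
  using add_cls[of "[(a, b)]" xs] assms by (simp add: pure_tensor_def)

text \<open>Concatenation gives associativity and the unit, the relation \<open>commute\<close>
  gives commutativity. Inverses have to wait until scalars are available.\<close>

lemma abelian_monoid_tensor: "abelian_monoid (tensor K M N)"
proof (rule abelian_monoidI)
  fix T U V
  assume T: "T \<in> carrier (tensor K M N)" and U: "U \<in> carrier (tensor K M N)"
    and V: "V \<in> carrier (tensor K M N)"
  then obtain xs ys zs where
    x: "xs \<in> sums" "T = cls xs" and y: "ys \<in> sums" "U = cls ys" and z: "zs \<in> sums" "V = cls zs"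
    by (elim carrier_tensorE) blast
  note e = cls_zero add_cls append_in_lists_conv cls_closed
  show "T \<oplus>\<^bsub>tensor K M N\<^esub> U \<in> carrier (tensor K M N)"
    using x y by (simp add: e del: in_lists_conv_set)
  show "T \<oplus>\<^bsub>tensor K M N\<^esub> U \<oplus>\<^bsub>tensor K M N\<^esub> V = T \<oplus>\<^bsub>tensor K M N\<^esub> (U \<oplus>\<^bsub>tensor K M N\<^esub> V)"
    using x y z by (simp add: e del: in_lists_conv_set)
  show "\<zero>\<^bsub>tensor K M N\<^esub> \<oplus>\<^bsub>tensor K M N\<^esub> T = T"
    using x by (simp add: e del: in_lists_conv_set)
  show "T \<oplus>\<^bsub>tensor K M N\<^esub> U = U \<oplus>\<^bsub>tensor K M N\<^esub> T"
    using x y cls_eqI[OF tensor_cong.commute] by (simp add: e del: in_lists_conv_set)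
qed (simp add: cls_zero cls_closed)

lemma smult_closed:
  assumes "c \<in> carrier K" "T \<in> carrier (tensor K M N)"
  shows "c \<odot>\<^bsub>tensor K M N\<^esub> T \<in> carrier (tensor K M N)"
  using assms(2)
  by (elim carrier_tensorE) (simp add: smult_cls[OF assms(1)] cls_closed scale_in_sums[OF assms(1)]
      del: in_lists_conv_set)

lemma pure_tensor_closed:
  "a \<in> carrier M \<Longrightarrow> b \<in> carrier N \<Longrightarrow> pure_tensor K M N a b \<in> carrier (tensor K M N)"
  unfolding pure_tensor_def by (rule cls_closed) simp

lemma pure_tensor_add_left:
  assumes "a \<in> carrier M" "a' \<in> carrier M" "b \<in> carrier N"
  shows "pure_tensor K M N (a \<oplus>\<^bsub>M\<^esub> a') b =
    pure_tensor K M N a b \<oplus>\<^bsub>tensor K M N\<^esub> pure_tensor K M N a' b"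
  using assms cls_eqI[OF tensor_cong.add_left, of a a' b] by (simp add: pure_tensor_def add_cls)

lemma pure_tensor_add_right:
  assumes "a \<in> carrier M" "b \<in> carrier N" "b' \<in> carrier N"
  shows "pure_tensor K M N a (b \<oplus>\<^bsub>N\<^esub> b') =
    pure_tensor K M N a b \<oplus>\<^bsub>tensor K M N\<^esub> pure_tensor K M N a b'"
  using assms cls_eqI[OF tensor_cong.add_right, of a b b'] by (simp add: pure_tensor_def add_cls)

lemma pure_tensor_smult_left:
  assumes "c \<in> carrier K" "a \<in> carrier M" "b \<in> carrier N"
  shows "pure_tensor K M N (c \<odot>\<^bsub>M\<^esub> a) b = c \<odot>\<^bsub>tensor K M N\<^esub> pure_tensor K M N a b"
  using assms by (simp add: pure_tensor_def smult_cls)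

lemma pure_tensor_smult_right:
  assumes "c \<in> carrier K" "a \<in> carrier M" "b \<in> carrier N"
  shows "pure_tensor K M N a (c \<odot>\<^bsub>N\<^esub> b) = c \<odot>\<^bsub>tensor K M N\<^esub> pure_tensor K M N a b"
  using assms cls_eqI[OF tensor_cong.scalar, of c a b] by (simp add: pure_tensor_def smult_cls)

lemma pure_tensor_bilinear: "pure_tensor K M N \<in> bilinear_maps K M N (tensor K M N)"
  by (intro bilinear_mapsI module_homI pure_tensor_closed pure_tensor_add_left pure_tensor_add_right
      pure_tensor_smult_left pure_tensor_smult_right)

text \<open>The negative of \<open>T\<close> is \<open>-1\<close> times \<open>T\<close>, so the
  laws for a sum of scalars and for the zero scalar precede the group axioms. These two go by
  induction over a sum of pure tensors, whereas the unit and associativity of scalars already hold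
  entrywise on lists.\<close>

lemma module_tensor: "module K (tensor K M N)"
proof -
  interpret T: abelian_monoid "tensor K M N" by (rule abelian_monoid_tensor)
  have distr: "(c \<oplus>\<^bsub>K\<^esub> d) \<odot>\<^bsub>tensor K M N\<^esub> cls xs =
      c \<odot>\<^bsub>tensor K M N\<^esub> cls xs \<oplus>\<^bsub>tensor K M N\<^esub> d \<odot>\<^bsub>tensor K M N\<^esub> cls xs"
    if c: "c \<in> carrier K" and d: "d \<in> carrier K" and "xs \<in> sums" for c d xs
    using that(3)
  proof induction
    case Nil
    show ?case using c d by (simp add: smult_cls add_cls)
  next
    case (Cons p xs)
    obtain a b where p: "p = (a, b)" "a \<in> carrier M" "b \<in> carrier N" using Cons by auto
    note cl = cls_closed[OF scale_in_sums[OF c Cons(2)]] cls_closed[OF scale_in_sums[OF d Cons(2)]]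
      scale_in_sums[OF c Cons(2)] scale_in_sums[OF d Cons(2)]
    have cd: "c \<oplus>\<^bsub>K\<^esub> d \<in> carrier K" using c d by simp
    have IH: "cls (scale (c \<oplus>\<^bsub>K\<^esub> d) xs) = cls (scale c xs) \<oplus>\<^bsub>tensor K M N\<^esub> cls (scale d xs)"
      using Cons by (simp only: smult_cls[OF c Cons(2)] smult_cls[OF d Cons(2)] smult_cls[OF cd Cons(2)])
    have ps: "p # xs \<in> sums" using Cons(1,2) by (rule lists.Cons)
    have s: "scale e (p # xs) = (e \<odot>\<^bsub>M\<^esub> a, b) # scale e xs" for e by (simp add: p)
    have m: "e \<odot>\<^bsub>M\<^esub> a \<in> carrier M" if "e \<in> carrier K" for e using that p by simp
    note C = Cons_cls[OF m p(3) scale_in_sums[OF _ Cons(2)]]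
    show ?case
      unfolding smult_cls[OF c ps] smult_cls[OF d ps] smult_cls[OF cd ps] s
        C[OF c c] C[OF d d] C[OF cd cd]
      unfolding IH M.smult_l_distr[OF c d p(2)]
        pure_tensor_add_left[OF m[OF c] m[OF d] p(3)]
      using cl pure_tensor_closed[OF m p(3)] c d by (simp add: T.a_ac del: in_lists_conv_set)
  qed
  \<comment> \<open>Scaling by zero does not empty a list but makes all first entries zero; the
    relation \<open>zero_left\<close> then removes them.\<close>
  have zero: "\<zero>\<^bsub>K\<^esub> \<odot>\<^bsub>tensor K M N\<^esub> cls xs = \<zero>\<^bsub>tensor K M N\<^esub>" if "xs \<in> sums" for xs
    using that
  proof induction
    case Nil
    show ?case by (simp add: smult_cls cls_zero)
  next
    case (Cons p xs)
    obtain a b where p: "p = (a, b)" "a \<in> carrier M" "b \<in> carrier N" using Cons by auto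
    have "pure_tensor K M N \<zero>\<^bsub>M\<^esub> b = \<zero>\<^bsub>tensor K M N\<^esub>"
      using cls_eqI[OF tensor_cong.zero_left, of b] p by (simp add: pure_tensor_def cls_zero)
    moreover have "p # xs \<in> sums" using Cons(1,2) by (rule lists.Cons)
    moreover have "cls (scale \<zero>\<^bsub>K\<^esub> xs) = \<zero>\<^bsub>tensor K M N\<^esub>"
      using Cons smult_cls[OF M.R.zero_closed Cons(2)] by simp
    ultimately show ?case
      using Cons_cls[OF M.M.zero_closed p(3) scale_in_sums[OF M.R.zero_closed Cons(2)]] p
      by (simp add: smult_cls del: in_lists_conv_set)
  qed
  have one: "\<one>\<^bsub>K\<^esub> \<odot>\<^bsub>tensor K M N\<^esub> cls xs = cls xs" if "xs \<in> sums" for xs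
  proof -
    have "scale \<one>\<^bsub>K\<^esub> xs = xs" using that by (intro map_idI) auto
    then show ?thesis using that by (simp add: smult_cls del: in_lists_conv_set)
  qed
  have assoc: "(c \<otimes>\<^bsub>K\<^esub> d) \<odot>\<^bsub>tensor K M N\<^esub> cls xs =
      c \<odot>\<^bsub>tensor K M N\<^esub> (d \<odot>\<^bsub>tensor K M N\<^esub> cls xs)"
    if c: "c \<in> carrier K" and d: "d \<in> carrier K" and x: "xs \<in> sums" for c d xs
  proof -
    have "scale (c \<otimes>\<^bsub>K\<^esub> d) xs = scale c (scale d xs)"
      using x c d by (auto simp: M.smult_assoc1)
    moreover have "c \<otimes>\<^bsub>K\<^esub> d \<in> carrier K" using c d by simp
    ultimately show ?thesis
      by (simp only: smult_cls c d x scale_in_sums[OF d x])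
  qed
  show ?thesis
  proof (rule moduleI)
    show "cring K" by (rule M.R.is_cring)
    show "abelian_group (tensor K M N)"
    proof (rule abelian_groupI)
      fix T assume T: "T \<in> carrier (tensor K M N)"
      then obtain xs where xs: "xs \<in> sums" "T = cls xs" by (elim carrier_tensorE)
      have "(\<ominus>\<^bsub>K\<^esub> \<one>\<^bsub>K\<^esub>) \<odot>\<^bsub>tensor K M N\<^esub> T \<oplus>\<^bsub>tensor K M N\<^esub> T = \<zero>\<^bsub>tensor K M N\<^esub>"
        using distr[of "\<ominus>\<^bsub>K\<^esub> \<one>\<^bsub>K\<^esub>" "\<one>\<^bsub>K\<^esub>", OF _ _ xs(1)] zero[OF xs(1)] one[OF xs(1)] xs(2)
        by (simp add: M.R.l_neg)
      then show "\<exists>U\<in>carrier (tensor K M N). U \<oplus>\<^bsub>tensor K M N\<^esub> T = \<zero>\<^bsub>tensor K M N\<^esub>"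
        using smult_closed[OF _ T] by blast
    qed (simp_all add: T.a_ac)
    show "c \<odot>\<^bsub>tensor K M N\<^esub> (T \<oplus>\<^bsub>tensor K M N\<^esub> U) =
        c \<odot>\<^bsub>tensor K M N\<^esub> T \<oplus>\<^bsub>tensor K M N\<^esub> c \<odot>\<^bsub>tensor K M N\<^esub> U"
      if c: "c \<in> carrier K" and T: "T \<in> carrier (tensor K M N)" and U: "U \<in> carrier (tensor K M N)"
      for c T U
    proof -
      obtain xs ys where x: "xs \<in> sums" "T = cls xs" and y: "ys \<in> sums" "U = cls ys"
        using T U by (elim carrier_tensorE) blast
      then have "xs @ ys \<in> sums" by auto
      then show ?thesis
        using x y c scale_in_sums[OF c x(1)] scale_in_sums[OF c y(1)]
        by (simp add: add_cls smult_cls del: in_lists_conv_set)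
    qed
    show "(c \<oplus>\<^bsub>K\<^esub> d) \<odot>\<^bsub>tensor K M N\<^esub> T =
        c \<odot>\<^bsub>tensor K M N\<^esub> T \<oplus>\<^bsub>tensor K M N\<^esub> d \<odot>\<^bsub>tensor K M N\<^esub> T"
      if "c \<in> carrier K" "d \<in> carrier K" "T \<in> carrier (tensor K M N)" for c d T
      using that(3) by (rule carrier_tensorE) (use that(1,2) distr in blast)
    show "(c \<otimes>\<^bsub>K\<^esub> d) \<odot>\<^bsub>tensor K M N\<^esub> T =
        c \<odot>\<^bsub>tensor K M N\<^esub> (d \<odot>\<^bsub>tensor K M N\<^esub> T)"
      if "c \<in> carrier K" "d \<in> carrier K" "T \<in> carrier (tensor K M N)" for c d T
      using that(3) by (rule carrier_tensorE) (use that(1,2) assoc in blast)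
    show "\<one>\<^bsub>K\<^esub> \<odot>\<^bsub>tensor K M N\<^esub> T = T" if "T \<in> carrier (tensor K M N)" for T
      using that by (rule carrier_tensorE) (use one in blast)
  qed (rule smult_closed)
qed

section \<open>Linear maps out of the tensor product\<close>

lemma tensor_lift_module_hom:
  assumes P: "module K P" and F: "F \<in> bilinear_maps K M N P"
  shows "tensor_lift P F \<in> module_hom K (tensor K M N) P"
proof -
  interpret P: module K P by fact
  note cl = bilinear_mapsD(1)[OF F]
  note lift = tensor_lift_class[OF M.module_axioms N.module_axioms P F]
  show ?thesis
  proof (rule module_homI)
    fix T assume "T \<in> carrier (tensor K M N)"
    then obtain xs where x: "xs \<in> sums" "T = cls xs" by (elim carrier_tensorE)
    show "tensor_lift P F T \<in> carrier P"
      unfolding x(2) lift[OF x(1)] by (rule P.formal_sum_closed[OF x(1) cl])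
    show "tensor_lift P F (c \<odot>\<^bsub>tensor K M N\<^esub> T) = c \<odot>\<^bsub>P\<^esub> tensor_lift P F T"
      if c: "c \<in> carrier K" for c
    proof -
      \<comment> \<open>Scaling alters first entries only, so linearity of \<open>F\<close> in its
        first variable pulls \<open>c\<close> out.\<close>
      have "formal_sum P F (scale c xs) = formal_sum P (\<lambda>a b. c \<odot>\<^bsub>P\<^esub> F a b) xs"
        using x(1) by induction (auto simp: bilinear_mapsD(4)[OF F _ _ c])
      then show ?thesis
        unfolding x(2) smult_cls[OF c x(1)] lift[OF x(1)] lift[OF scale_in_sums[OF c x(1)]]
        using P.formal_sum_smult[OF x(1) cl c] by simp
    qed
  next
    fix T U assume "T \<in> carrier (tensor K M N)" "U \<in> carrier (tensor K M N)"
    then obtain xs ys where x: "xs \<in> sums" "T = cls xs" and y: "ys \<in> sums" "U = cls ys"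
      by (elim carrier_tensorE) blast
    then have "xs @ ys \<in> sums" by auto
    then show "tensor_lift P F (T \<oplus>\<^bsub>tensor K M N\<^esub> U) = tensor_lift P F T \<oplus>\<^bsub>P\<^esub> tensor_lift P F U"
      using P.formal_sum_append[OF x(1) y(1) cl]
      by (simp add: x(2) y(2) add_cls[OF x(1) y(1)] lift[OF x(1)] lift[OF y(1)] lift
          del: in_lists_conv_set)
  qed
qed

lemma tensor_lift_pure:
  assumes P: "module K P" and F: "F \<in> bilinear_maps K M N P"
    and "a \<in> carrier M" "b \<in> carrier N"
  shows "tensor_lift P F (pure_tensor K M N a b) = F a b"
proof -
  interpret P: module K P by fact
  show ?thesis
    using assms(3,4) bilinear_mapsD(1)[OF F assms(3,4)]
    by (simp add: pure_tensor_def tensor_lift_class[OF M.module_axioms N.module_axioms P F])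
qed

text \<open>With \<open>T\<close> fixed, all sums run along the one list
  \<open>tensor_rep T\<close>, so linearity in the parameter holds term by term.\<close>

lemma hom_tensor_lift:
  assumes P: "module K P" and L: "module K L" and T: "T \<in> carrier (tensor K M N)"
    and F: "\<And>a b. a \<in> carrier M \<Longrightarrow> b \<in> carrier N \<Longrightarrow> (\<lambda>x. F x a b) \<in> module_hom K L P"
  shows "(\<lambda>x. tensor_lift P (F x) T) \<in> module_hom K L P"
proof -
  interpret P: module K P by fact
  interpret L: module K L by fact
  note r = rep_in_sums[OF T]
  have cl: "F x a b \<in> carrier P" if "x \<in> carrier L" "a \<in> carrier M" "b \<in> carrier N" for x a b
    using module_hom_mem[OF F[OF that(2,3)] that(1)] .
  show ?thesis
    unfolding tensor_lift_def
  proof (rule module_homI)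
    fix x assume x: "x \<in> carrier L"
    show "formal_sum P (F x) (tensor_rep T) \<in> carrier P"
      by (rule P.formal_sum_closed[OF r cl[OF x]])
    show "formal_sum P (F (x \<oplus>\<^bsub>L\<^esub> y)) (tensor_rep T) =
        formal_sum P (F x) (tensor_rep T) \<oplus>\<^bsub>P\<^esub> formal_sum P (F y) (tensor_rep T)"
      if y: "y \<in> carrier L" for y
      by (subst P.formal_sum_add[OF r cl[OF x] cl[OF y], symmetric], assumption+,
          rule formal_sum_cong_fun[OF r], rule module_hom_add[OF F x y])
    show "formal_sum P (F (c \<odot>\<^bsub>L\<^esub> x)) (tensor_rep T) = c \<odot>\<^bsub>P\<^esub> formal_sum P (F x) (tensor_rep T)"
      if c: "c \<in> carrier K" for c
      by (subst P.formal_sum_smult[OF r cl[OF x] c, symmetric], assumption+,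
          rule formal_sum_cong_fun[OF r], rule module_hom_smult[OF F c x])
  qed
qed

end


section \<open>Sweedler sums\<close>

context hopf_algebra
begin

abbreviation sweedler :: "('p, 'w) ring_scheme \<Rightarrow> ('h \<Rightarrow> 'h \<Rightarrow> 'p) \<Rightarrow> 'h \<Rightarrow> 'p" where
  "sweedler P F h \<equiv> tensor_lift P F (comult H h)"

lemma module_H: "module K H"
  by (rule vectorspace.axioms(1)[OF vectorspace_axioms])

sublocale HH: tensor_modules K H H
  by (intro tensor_modules.intro module_H)

sublocale HHH: tensor_modules K H "tensor K H H"
  by (intro tensor_modules.intro module_H HH.module_tensor)

sublocale HH_H: tensor_modules K "tensor K H H" H
  by (intro tensor_modules.intro module_H HH.module_tensor)

lemma comult_closed: "h \<in> carrier H \<Longrightarrow> comult H h \<in> carrier (tensor K H H)"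
  by (rule module_hom_mem[OF comult_linear])

lemma rep_comult: "h \<in> carrier H \<Longrightarrow> tensor_rep (comult H h) \<in> lists (carrier H \<times> carrier H)"
  by (rule HH.rep_in_sums[OF comult_closed])

lemma counit_closed: "h \<in> carrier H \<Longrightarrow> counit H h \<in> carrier K"
  by (rule ring_hom_closed[OF counit_ring_hom])

lemma antipode_closed: "h \<in> carrier H \<Longrightarrow> antipode H h \<in> carrier H"
  by (rule module_hom_mem[OF antipode_linear])

lemma mult_closed: "a \<in> carrier H \<Longrightarrow> b \<in> carrier H \<Longrightarrow> a \<otimes>\<^bsub>H\<^esub> b \<in> carrier H"
  by (rule bilinear_mapsD(1)[OF mult_bilinear])

text \<open>An arbitrary linear \<open>f\<close> stands in the open place, so that linearity of a
  nested expression is proved by peeling off one operation at a time down to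
  \<open>module_hom_ident\<close>. The later rules for the antipode and for actions have the same
  shape.\<close>

lemma hom_mult_left:
  "f \<in> module_hom K L H \<Longrightarrow> b \<in> carrier H \<Longrightarrow> (\<lambda>x. f x \<otimes>\<^bsub>H\<^esub> b) \<in> module_hom K L H"
  by (rule bilinear_maps_left[OF mult_bilinear])

lemma hom_mult_right:
  "f \<in> module_hom K L H \<Longrightarrow> a \<in> carrier H \<Longrightarrow> (\<lambda>x. a \<otimes>\<^bsub>H\<^esub> f x) \<in> module_hom K L H"
  by (rule bilinear_maps_right[OF mult_bilinear])

lemma hom_antipode:
  "f \<in> module_hom K L H \<Longrightarrow> (\<lambda>x. antipode H (f x)) \<in> module_hom K L H"
  by (rule module_hom_comp[OF antipode_linear])

lemma sweedler_cong:
  assumes "h \<in> carrier H" "\<And>a b. a \<in> carrier H \<Longrightarrow> b \<in> carrier H \<Longrightarrow> F a b = G a b"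
  shows "sweedler P F h = sweedler P G h"
  unfolding tensor_lift_def by (rule formal_sum_cong_fun[OF rep_comult[OF assms(1)] assms(2)])

lemma sweedler_closed:
  assumes "module K P" "h \<in> carrier H"
    and "\<And>a b. a \<in> carrier H \<Longrightarrow> b \<in> carrier H \<Longrightarrow> F a b \<in> carrier P"
  shows "sweedler P F h \<in> carrier P"
proof -
  interpret P: module K P by fact
  show ?thesis
    unfolding tensor_lift_def by (rule P.formal_sum_closed[OF rep_comult[OF assms(2)] assms(3)])
qed

text \<open>Both sides run along the same representative of \<open>comult H h\<close>, so no
  bilinearity of \<open>F\<close> has to be proved before a map is moved into the sum.\<close>

lemma sweedler_module_hom:
  assumes "module K P" "module K Q" "f \<in> module_hom K P Q" "h \<in> carrier H"
    and "\<And>a b. a \<in> carrier H \<Longrightarrow> b \<in> carrier H \<Longrightarrow> F a b \<in> carrier P"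
  shows "f (sweedler P F h) = sweedler Q (\<lambda>a b. f (F a b)) h"
  unfolding tensor_lift_def
  by (rule conjunct2[OF formal_sum_module_hom[OF assms(1-3) rep_comult[OF assms(4)] assms(5)]])

lemma sweedler_swap:
  assumes "module K P" "g \<in> carrier H" "h \<in> carrier H"
    and "\<And>a b c d. a \<in> carrier H \<Longrightarrow> b \<in> carrier H \<Longrightarrow> c \<in> carrier H \<Longrightarrow> d \<in> carrier H \<Longrightarrow>
      F a b c d \<in> carrier P"
  shows "sweedler P (\<lambda>a b. sweedler P (F a b) h) g =
    sweedler P (\<lambda>c d. sweedler P (\<lambda>a b. F a b c d) g) h"
proof -
  interpret P: module K P by fact
  show ?thesis
    unfolding tensor_lift_def
    by (rule P.formal_sum_swap[OF rep_comult[OF assms(2)] rep_comult[OF assms(3)] assms(4)])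
qed

lemma hom_sweedler:
  assumes P: "module K P" and h: "h \<in> carrier H"
    and L: "module K L"
    and F: "\<And>a b. a \<in> carrier H \<Longrightarrow> b \<in> carrier H \<Longrightarrow> (\<lambda>x. F x a b) \<in> module_hom K L P"
  shows "(\<lambda>x. sweedler P (F x) h) \<in> module_hom K L P"
  by (rule HH.hom_tensor_lift[OF P L comult_closed[OF h] F])

text \<open>In contrast to \<open>hom_sweedler\<close>, the comultiplied element varies here, and
  its representative with it; hence \<open>F\<close> must factor through the tensor product.\<close>

lemma hom_sweedler_arg:
  assumes "module K P" "F \<in> bilinear_maps K H H P" "f \<in> module_hom K L H"
  shows "(\<lambda>x. sweedler P F (f x)) \<in> module_hom K L P"
  by (rule module_hom_comp[OF HH.tensor_lift_module_hom[OF assms(1,2)]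
        module_hom_comp[OF comult_linear assms(3)]])

section \<open>The Hopf algebra axioms carried along linear maps\<close>

lemma sweedler_counit_left:
  assumes "module K P" "f \<in> module_hom K H P" "h \<in> carrier H"
  shows "sweedler P (\<lambda>a b. counit H a \<odot>\<^bsub>P\<^esub> f b) h = f h"
proof -
  interpret H: module K H by (rule module_H)
  have "f h = f (sweedler H (\<lambda>a b. counit H a \<odot>\<^bsub>H\<^esub> b) h)"
    by (simp only: counit_left[OF assms(3)])
  also have "\<dots> = sweedler P (\<lambda>a b. f (counit H a \<odot>\<^bsub>H\<^esub> b)) h"
    by (rule sweedler_module_hom[OF module_H assms]) (simp add: counit_closed)
  also have "\<dots> = sweedler P (\<lambda>a b. counit H a \<odot>\<^bsub>P\<^esub> f b) h"
    by (rule sweedler_cong[OF assms(3)]) (simp add: module_hom_smult[OF assms(2)] counit_closed)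
  finally show ?thesis ..
qed

lemma sweedler_counit_right:
  assumes "module K P" "f \<in> module_hom K H P" "h \<in> carrier H"
  shows "sweedler P (\<lambda>a b. counit H b \<odot>\<^bsub>P\<^esub> f a) h = f h"
proof -
  interpret H: module K H by (rule module_H)
  have "f h = f (sweedler H (\<lambda>a b. counit H b \<odot>\<^bsub>H\<^esub> a) h)"
    by (simp only: counit_right[OF assms(3)])
  also have "\<dots> = sweedler P (\<lambda>a b. f (counit H b \<odot>\<^bsub>H\<^esub> a)) h"
    by (rule sweedler_module_hom[OF module_H assms]) (simp add: counit_closed)
  also have "\<dots> = sweedler P (\<lambda>a b. counit H b \<odot>\<^bsub>P\<^esub> f a) h"
    by (rule sweedler_cong[OF assms(3)]) (simp add: module_hom_smult[OF assms(2)] counit_closed)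
  finally show ?thesis ..
qed

text \<open>The axiom is an identity in \<open>H\<close>, and \<open>f\<close> carries it to
  \<open>P\<close>. Typically \<open>f\<close> lets its argument act on a fixed vector or multiplies
  it by fixed factors.\<close>

lemma sweedler_antipode_left:
  assumes "module K P" "f \<in> module_hom K H P" "h \<in> carrier H"
  shows "sweedler P (\<lambda>a b. f (antipode H a \<otimes>\<^bsub>H\<^esub> b)) h = counit H h \<odot>\<^bsub>P\<^esub> f \<one>\<^bsub>H\<^esub>"
proof -
  have "sweedler P (\<lambda>a b. f (antipode H a \<otimes>\<^bsub>H\<^esub> b)) h =
      f (sweedler H (\<lambda>a b. antipode H a \<otimes>\<^bsub>H\<^esub> b) h)"
    by (rule sweedler_module_hom[OF module_H assms, symmetric])
      (intro mult_closed antipode_closed)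
  then show ?thesis
    by (simp add: antipode_left assms(3) module_hom_smult[OF assms(2)] counit_closed)
qed

lemma sweedler_antipode_right:
  assumes "module K P" "f \<in> module_hom K H P" "h \<in> carrier H"
  shows "sweedler P (\<lambda>a b. f (a \<otimes>\<^bsub>H\<^esub> antipode H b)) h = counit H h \<odot>\<^bsub>P\<^esub> f \<one>\<^bsub>H\<^esub>"
proof -
  have "sweedler P (\<lambda>a b. f (a \<otimes>\<^bsub>H\<^esub> antipode H b)) h =
      f (sweedler H (\<lambda>a b. a \<otimes>\<^bsub>H\<^esub> antipode H b) h)"
    by (rule sweedler_module_hom[OF module_H assms, symmetric])
      (intro mult_closed antipode_closed)
  then show ?thesis
    by (simp add: antipode_right assms(3) module_hom_smult[OF assms(2)] counit_closed)
qed

text \<open>As \<open>comult H\<close> is a ring homomorphism, the products of the entries of two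
  representatives form a list in the class of the product. It need not be the list chosen for that
  class, so bilinearity of \<open>F\<close> is used to pass to it.\<close>

lemma sweedler_mult:
  assumes P: "module K P" and F: "F \<in> bilinear_maps K H H P"
    and g: "g \<in> carrier H" and h: "h \<in> carrier H"
  shows "sweedler P F (g \<otimes>\<^bsub>H\<^esub> h) =
    sweedler P (\<lambda>a b. sweedler P (\<lambda>c d. F (a \<otimes>\<^bsub>H\<^esub> c) (b \<otimes>\<^bsub>H\<^esub> d)) h) g"
proof -
  interpret P: module K P by fact
  let ?xs = "[(a \<otimes>\<^bsub>H\<^esub> c, b \<otimes>\<^bsub>H\<^esub> d). (a, b) \<leftarrow> tensor_rep (comult H g), (c, d) \<leftarrow> tensor_rep (comult H h)]"
  have "comult H (g \<otimes>\<^bsub>H\<^esub> h) = tensor_class K H H ?xs"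
    using ring_hom_mult[OF comult_ring_hom g h] by (simp add: tensor_def)
  moreover have "?xs \<in> lists (carrier H \<times> carrier H)"
    using rep_comult[OF g] rep_comult[OF h] mult_closed by fastforce
  ultimately have "sweedler P F (g \<otimes>\<^bsub>H\<^esub> h) = formal_sum P F ?xs"
    using tensor_lift_class[OF module_H module_H P F] by (simp del: in_lists_conv_set)
  also have "\<dots> = sweedler P (\<lambda>a b. sweedler P (\<lambda>c d. F (a \<otimes>\<^bsub>H\<^esub> c) (b \<otimes>\<^bsub>H\<^esub> d)) h) g"
    unfolding tensor_lift_def
    by (rule P.formal_sum_product[OF rep_comult[OF g] rep_comult[OF h] _ bilinear_mapsD(1)[OF F]])
      (simp_all add: mult_closed)
  finally show ?thesis .
qed

lemma sweedler_one:
  assumes "module K P" "F \<in> bilinear_maps K H H P"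
  shows "sweedler P F \<one>\<^bsub>H\<^esub> = F \<one>\<^bsub>H\<^esub> \<one>\<^bsub>H\<^esub>"
proof -
  have "comult H \<one>\<^bsub>H\<^esub> = pure_tensor K H H \<one>\<^bsub>H\<^esub> \<one>\<^bsub>H\<^esub>"
    using ring_hom_one[OF comult_ring_hom] by (simp add: tensor_def pure_tensor_def)
  then show ?thesis
    using HH.tensor_lift_pure[OF assms] by simp
qed

section \<open>Coassociativity for trilinear maps\<close>

definition trilinear :: "('k, 'p, 'w) module_scheme \<Rightarrow> ('h \<Rightarrow> 'h \<Rightarrow> 'h \<Rightarrow> 'p) \<Rightarrow> bool" where
  "trilinear P T \<longleftrightarrow>
     (\<forall>b\<in>carrier H. \<forall>c\<in>carrier H. (\<lambda>a. T a b c) \<in> module_hom K H P) \<and>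
     (\<forall>a\<in>carrier H. \<forall>c\<in>carrier H. (\<lambda>b. T a b c) \<in> module_hom K H P) \<and>
     (\<forall>a\<in>carrier H. \<forall>b\<in>carrier H. (\<lambda>c. T a b c) \<in> module_hom K H P)"

lemma trilinearI:
  assumes "\<And>b c. b \<in> carrier H \<Longrightarrow> c \<in> carrier H \<Longrightarrow> (\<lambda>a. T a b c) \<in> module_hom K H P"
    and "\<And>a c. a \<in> carrier H \<Longrightarrow> c \<in> carrier H \<Longrightarrow> (\<lambda>b. T a b c) \<in> module_hom K H P"
    and "\<And>a b. a \<in> carrier H \<Longrightarrow> b \<in> carrier H \<Longrightarrow> (\<lambda>c. T a b c) \<in> module_hom K H P"
  shows "trilinear P T"
  using assms unfolding trilinear_def by blast

text \<open>The iterated sums are the values of one linear map \<open>\<Phi>\<close>, induced by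
  \<open>T\<close> on the right-nested triple tensor product, at the two sides of the
  coassociativity axiom. The left side arrives there through \<open>tensor_assoc\<close>.\<close>

lemma sweedler_coassoc:
  assumes P: "module K P" and T: "trilinear P T" and h: "h \<in> carrier H"
  shows "sweedler P (\<lambda>x c. sweedler P (\<lambda>a b. T a b c) x) h =
    sweedler P (\<lambda>a y. sweedler P (T a) y) h"
proof -
  let ?HH = "tensor K H H"
  let ?Q = "tensor K H ?HH"
  have T1: "(\<lambda>a. T a b c) \<in> module_hom K H P" and T2: "(\<lambda>b. T a b c) \<in> module_hom K H P"
    and T3: "(\<lambda>c. T a b c) \<in> module_hom K H P"
    if "a \<in> carrier H" "b \<in> carrier H" "c \<in> carrier H" for a b c
    using T that unfolding trilinear_def by blast+
  note mods = module_H HH.module_tensor HHH.module_tensor HH_H.module_tensor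
  \<comment> \<open>The lift has two stages, first over the inner pair with \<open>a\<close> fixed,
    then over \<open>a\<close> and the inner tensor. The second stage needs the first to be linear
    in both of its arguments.\<close>
  have "tensor_lift P (T a) \<in> module_hom K ?HH P" if "a \<in> carrier H" for a
    by (rule HH.tensor_lift_module_hom[OF P], rule bilinear_mapsI) (use that T2 T3 in auto)
  moreover have "(\<lambda>a. tensor_lift P (T a) t) \<in> module_hom K H P" if t: "t \<in> carrier ?HH" for t
    by (rule HH.hom_tensor_lift[OF P module_H t]) (use T T1 in \<open>simp add: trilinear_def\<close>)
  ultimately have \<Phi>': "(\<lambda>a. tensor_lift P (T a)) \<in> bilinear_maps K H ?HH P"
    by (intro bilinear_mapsI)
  define \<Phi> where "\<Phi> = tensor_lift P (\<lambda>a. tensor_lift P (T a))"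
  have \<Phi>: "\<Phi> \<in> module_hom K ?Q P"
    unfolding \<Phi>_def by (rule HHH.tensor_lift_module_hom[OF P \<Phi>'])
  have \<Phi>_pure: "\<Phi> (pure_tensor K H ?HH a t) = tensor_lift P (T a) t"
    if "a \<in> carrier H" "t \<in> carrier ?HH" for a t
    unfolding \<Phi>_def by (rule HHH.tensor_lift_pure[OF P \<Phi>' that])
  have lift_pure: "tensor_lift P (T a) (pure_tensor K H H b c) = T a b c"
    if "a \<in> carrier H" "b \<in> carrier H" "c \<in> carrier H" for a b c
    by (rule HH.tensor_lift_pure[OF P bilinear_mapsI]) (use that T2 T3 in auto)

  \<comment> \<open>\<open>tensor_assoc\<close> is the lift of this map; bilinearity of
    \<open>A\<close> allows the lift to be evaluated on the pure tensors that make up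
    \<open>tensor_map\<close>.\<close>
  define A where "A = (\<lambda>t c. tensor_lift ?Q (\<lambda>a b. pure_tensor K H ?HH a (pure_tensor K H H b c)) t)"
  note pcl = HHH.pure_tensor_closed HH.pure_tensor_closed
  note pl = bilinear_maps_left[OF HHH.pure_tensor_bilinear module_hom_ident]
    and pr = bilinear_maps_right[OF HHH.pure_tensor_bilinear]
    and qr = bilinear_maps_right[OF HH.pure_tensor_bilinear module_hom_ident]
    and ql = bilinear_maps_left[OF HH.pure_tensor_bilinear module_hom_ident]
  have A: "A \<in> bilinear_maps K ?HH H ?Q"
  proof (rule bilinear_mapsI)
    fix c assume c: "c \<in> carrier H"
    have "(\<lambda>a b. pure_tensor K H ?HH a (pure_tensor K H H b c)) \<in> bilinear_maps K H H ?Q"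
      by (intro bilinear_mapsI pl pr ql pcl c)
    then show "(\<lambda>t. A t c) \<in> module_hom K ?HH ?Q"
      unfolding A_def by (rule HH.tensor_lift_module_hom[OF mods(3)])
  next
    fix t assume "t \<in> carrier ?HH"
    then show "(\<lambda>c. A t c) \<in> module_hom K H ?Q"
      unfolding A_def by (rule HH.hom_tensor_lift[OF mods(3) module_H]) (intro pr qr)
  qed
  have assoc: "tensor_assoc K H H H = tensor_lift ?Q A"
    unfolding tensor_assoc_def A_def Let_def by simp
  have L: "tensor_assoc K H H H (tensor_map K ?HH H (comult H) id (comult H h)) =
      sweedler ?Q (\<lambda>x c. A (comult H x) c) h"
  proof -
    have "tensor_lift ?Q A (sweedler (tensor K ?HH H) (\<lambda>x c. pure_tensor K ?HH H (comult H x) c) h) =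
        sweedler ?Q (\<lambda>x c. tensor_lift ?Q A (pure_tensor K ?HH H (comult H x) c)) h"
      by (rule sweedler_module_hom[OF mods(4,3) HH_H.tensor_lift_module_hom[OF mods(3) A] h])
        (intro HH_H.pure_tensor_closed comult_closed)
    also have "\<dots> = sweedler ?Q (\<lambda>x c. A (comult H x) c) h"
      by (rule sweedler_cong[OF h]) (intro HH_H.tensor_lift_pure[OF mods(3) A] comult_closed)
    finally show ?thesis unfolding assoc tensor_map_def id_apply .
  qed
  have "\<Phi> (sweedler ?Q (\<lambda>x c. A (comult H x) c) h) = sweedler P (\<lambda>x c. \<Phi> (A (comult H x) c)) h"
    by (rule sweedler_module_hom[OF mods(3) P \<Phi> h]) (intro bilinear_mapsD(1)[OF A] comult_closed)
  also have "\<dots> = sweedler P (\<lambda>x c. sweedler P (\<lambda>a b. T a b c) x) h"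
  proof (rule sweedler_cong[OF h])
    fix x c assume x: "x \<in> carrier H" and c: "c \<in> carrier H"
    have "\<Phi> (A (comult H x) c) =
        sweedler P (\<lambda>a b. \<Phi> (pure_tensor K H ?HH a (pure_tensor K H H b c))) x"
      unfolding A_def by (rule sweedler_module_hom[OF mods(3) P \<Phi> x]) (intro pcl c)
    also have "\<dots> = sweedler P (\<lambda>a b. T a b c) x"
      by (rule sweedler_cong[OF x]) (simp add: \<Phi>_pure lift_pure pcl c)
    finally show "\<Phi> (A (comult H x) c) = sweedler P (\<lambda>a b. T a b c) x" .
  qed
  finally have 1: "\<Phi> (tensor_assoc K H H H (tensor_map K ?HH H (comult H) id (comult H h))) =
      sweedler P (\<lambda>x c. sweedler P (\<lambda>a b. T a b c) x) h"
    unfolding L .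
  have "\<Phi> (tensor_map K H ?HH id (comult H) (comult H h)) =
      sweedler P (\<lambda>a y. \<Phi> (pure_tensor K H ?HH a (comult H y))) h"
    unfolding tensor_map_def id_apply
    by (rule sweedler_module_hom[OF mods(3) P \<Phi> h]) (intro pcl comult_closed)
  also have "\<dots> = sweedler P (\<lambda>a y. sweedler P (T a) y) h"
    by (rule sweedler_cong[OF h]) (simp add: \<Phi>_pure comult_closed)
  finally show ?thesis
    using 1 coassoc[OF h] by simp
qed

lemma hom_smult:
  assumes "module K P" "f \<in> module_hom K L P" "c \<in> carrier K"
  shows "(\<lambda>x. c \<odot>\<^bsub>P\<^esub> f x) \<in> module_hom K L P"
proof -
  interpret P: module K P by fact
  show ?thesis
    by (rule module_homI)
      (simp_all add: assms(3) module_hom_mem[OF assms(2)] module_hom_add[OF assms(2)]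
        module_hom_smult[OF assms(2)] P.smult_r_distr P.smult_assoc1[symmetric] m_comm)
qed

lemma trilinearD:
  assumes "trilinear P T"
  shows "f \<in> module_hom K L H \<Longrightarrow> b \<in> carrier H \<Longrightarrow> c \<in> carrier H \<Longrightarrow>
      (\<lambda>x. T (f x) b c) \<in> module_hom K L P"
    and "f \<in> module_hom K L H \<Longrightarrow> a \<in> carrier H \<Longrightarrow> c \<in> carrier H \<Longrightarrow>
      (\<lambda>x. T a (f x) c) \<in> module_hom K L P"
    and "f \<in> module_hom K L H \<Longrightarrow> a \<in> carrier H \<Longrightarrow> b \<in> carrier H \<Longrightarrow>
      (\<lambda>x. T a b (f x)) \<in> module_hom K L P"
proof -
  have 1: "(\<lambda>a. T a b c) \<in> module_hom K H P" if "b \<in> carrier H" "c \<in> carrier H" for b c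
    using assms that unfolding trilinear_def by blast
  have 2: "(\<lambda>b. T a b c) \<in> module_hom K H P" if "a \<in> carrier H" "c \<in> carrier H" for a c
    using assms that unfolding trilinear_def by blast
  have 3: "(\<lambda>c. T a b c) \<in> module_hom K H P" if "a \<in> carrier H" "b \<in> carrier H" for a b
    using assms that unfolding trilinear_def by blast
  show "(\<lambda>x. T (f x) b c) \<in> module_hom K L P"
    if "f \<in> module_hom K L H" "b \<in> carrier H" "c \<in> carrier H"
    by (rule module_hom_comp[OF 1[OF that(2,3)] that(1)])
  show "(\<lambda>x. T a (f x) c) \<in> module_hom K L P"
    if "f \<in> module_hom K L H" "a \<in> carrier H" "c \<in> carrier H"
    by (rule module_hom_comp[OF 2[OF that(2,3)] that(1)])
  show "(\<lambda>x. T a b (f x)) \<in> module_hom K L P"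
    if "f \<in> module_hom K L H" "a \<in> carrier H" "b \<in> carrier H"
    by (rule module_hom_comp[OF 3[OF that(2,3)] that(1)])
qed

lemmas hom_intros = module_hom_ident hom_mult_left hom_mult_right hom_antipode

lemmas closed_intros = mult_closed antipode_closed H.one_closed

text \<open>The reversed order leaves \<open>counit H y\<close> outermost, the shape in which the
  counit law can remove the leg \<open>y\<close> while \<open>x\<close> is still fixed.\<close>

lemma counit_mult_smult:
  assumes "module K P" "x \<in> carrier H" "y \<in> carrier H" "p \<in> carrier P"
  shows "counit H (x \<otimes>\<^bsub>H\<^esub> y) \<odot>\<^bsub>P\<^esub> p = counit H y \<odot>\<^bsub>P\<^esub> (counit H x \<odot>\<^bsub>P\<^esub> p)"
proof -
  interpret P: module K P by fact
  show ?thesis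
    using assms(2-4) ring_hom_mult[OF counit_ring_hom assms(2,3)]
      P.smult_assoc1[of "counit H y" "counit H x" p] m_comm[of "counit H x" "counit H y"]
    by (simp add: counit_closed)
qed

section \<open>The antipode reverses products\<close>

lemma counit_one: "counit H \<one>\<^bsub>H\<^esub> = \<one>\<^bsub>K\<^esub>"
  by (rule ring_hom_one[OF counit_ring_hom])

lemma antipode_one: "antipode H \<one>\<^bsub>H\<^esub> = \<one>\<^bsub>H\<^esub>"
proof -
  interpret H: module K H by (rule module_H)
  have "sweedler H (\<lambda>a b. antipode H a \<otimes>\<^bsub>H\<^esub> b) \<one>\<^bsub>H\<^esub> = antipode H \<one>\<^bsub>H\<^esub> \<otimes>\<^bsub>H\<^esub> \<one>\<^bsub>H\<^esub>"
    by (rule sweedler_one[OF module_H]) (intro bilinear_mapsI hom_intros closed_intros)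
  then show ?thesis
    using antipode_left[OF H.one_closed] by (simp add: antipode_closed counit_one)
qed

text \<open>For the convolution product on maps of two variables, \<open>S(gh)\<close> is a left
  inverse and \<open>S(h)S(g)\<close> a right inverse of the multiplication, so they agree.
  \<open>E\<close> is the triple convolution product, evaluated by cancelling on either
  side.\<close>

lemma antipode_mult:
  assumes g: "g \<in> carrier H" and h: "h \<in> carrier H"
  shows "antipode H (g \<otimes>\<^bsub>H\<^esub> h) = antipode H h \<otimes>\<^bsub>H\<^esub> antipode H g"
proof -
  interpret H: module K H by (rule module_H)
  let ?S = "antipode H"
  note cl = closed_intros counit_closed
  \<comment> \<open>The legs \<open>p\<close> and \<open>q\<close> come from comultiplying the
    product of \<open>x\<close> and \<open>y\<close> as a whole, so the left cancellation applies
    directly.\<close>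
  define E where "E = sweedler H (\<lambda>x c. sweedler H (\<lambda>y d.
    sweedler H (\<lambda>p q. ?S p \<otimes>\<^bsub>H\<^esub> (q \<otimes>\<^bsub>H\<^esub> (?S d \<otimes>\<^bsub>H\<^esub> ?S c))) (x \<otimes>\<^bsub>H\<^esub> y)) h) g"
  have "E = sweedler H (\<lambda>x c. counit H x \<odot>\<^bsub>H\<^esub> (?S h \<otimes>\<^bsub>H\<^esub> ?S c)) g"
    unfolding E_def
  proof (rule sweedler_cong[OF g])
    fix x c assume x: "x \<in> carrier H" and c: "c \<in> carrier H"
    have "sweedler H (\<lambda>y d. sweedler H (\<lambda>p q. ?S p \<otimes>\<^bsub>H\<^esub> (q \<otimes>\<^bsub>H\<^esub> (?S d \<otimes>\<^bsub>H\<^esub> ?S c))) (x \<otimes>\<^bsub>H\<^esub> y)) h =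
        sweedler H (\<lambda>y d. counit H y \<odot>\<^bsub>H\<^esub> (counit H x \<odot>\<^bsub>H\<^esub> (?S d \<otimes>\<^bsub>H\<^esub> ?S c))) h"
    proof (rule sweedler_cong[OF h])
      fix y d assume y: "y \<in> carrier H" and d: "d \<in> carrier H"
      let ?w = "?S d \<otimes>\<^bsub>H\<^esub> ?S c"
      have "sweedler H (\<lambda>p q. ?S p \<otimes>\<^bsub>H\<^esub> (q \<otimes>\<^bsub>H\<^esub> ?w)) (x \<otimes>\<^bsub>H\<^esub> y) =
          sweedler H (\<lambda>p q. (?S p \<otimes>\<^bsub>H\<^esub> q) \<otimes>\<^bsub>H\<^esub> ?w) (x \<otimes>\<^bsub>H\<^esub> y)"
        by (rule sweedler_cong) (simp_all add: cl x y c d H.m_assoc)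
      also have "\<dots> = counit H (x \<otimes>\<^bsub>H\<^esub> y) \<odot>\<^bsub>H\<^esub> (\<one>\<^bsub>H\<^esub> \<otimes>\<^bsub>H\<^esub> ?w)"
        by (rule sweedler_antipode_left[OF module_H]) (intro hom_intros cl x y c d)+
      also have "\<dots> = counit H y \<odot>\<^bsub>H\<^esub> (counit H x \<odot>\<^bsub>H\<^esub> ?w)"
        by (simp add: cl x y c d counit_mult_smult[OF module_H])
      finally show "sweedler H (\<lambda>p q. ?S p \<otimes>\<^bsub>H\<^esub> (q \<otimes>\<^bsub>H\<^esub> ?w)) (x \<otimes>\<^bsub>H\<^esub> y) =
        counit H y \<odot>\<^bsub>H\<^esub> (counit H x \<odot>\<^bsub>H\<^esub> ?w)" .
    qed
    also have "\<dots> = counit H x \<odot>\<^bsub>H\<^esub> (?S h \<otimes>\<^bsub>H\<^esub> ?S c)"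
      by (rule sweedler_counit_left[OF module_H _ h]) (intro hom_smult module_H hom_intros cl x c)
    finally show "sweedler H (\<lambda>y d. sweedler H (\<lambda>p q. ?S p \<otimes>\<^bsub>H\<^esub> (q \<otimes>\<^bsub>H\<^esub> (?S d \<otimes>\<^bsub>H\<^esub> ?S c))) (x \<otimes>\<^bsub>H\<^esub> y)) h =
      counit H x \<odot>\<^bsub>H\<^esub> (?S h \<otimes>\<^bsub>H\<^esub> ?S c)" .
  qed
  also have "\<dots> = ?S h \<otimes>\<^bsub>H\<^esub> ?S g"
    by (rule sweedler_counit_left[OF module_H _ g]) (intro hom_intros cl h)
  finally have 1: "E = ?S h \<otimes>\<^bsub>H\<^esub> ?S g" .
  \<comment> \<open>For the right cancellation the product is comultiplied factor by factor. The
    legs \<open>q\<close> and \<open>d\<close> of \<open>h\<close> are adjacent and cancel first;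
    \<open>b\<close> and \<open>c\<close>, legs of \<open>g\<close>, enclose them.\<close>
  have "E = sweedler H (\<lambda>x c. sweedler H (\<lambda>a b. ?S (a \<otimes>\<^bsub>H\<^esub> h) \<otimes>\<^bsub>H\<^esub> (b \<otimes>\<^bsub>H\<^esub> ?S c)) x) g"
    unfolding E_def
  proof (rule sweedler_cong[OF g])
    fix x c assume x: "x \<in> carrier H" and c: "c \<in> carrier H"
    let ?T = "\<lambda>a b p q d. ?S (a \<otimes>\<^bsub>H\<^esub> p) \<otimes>\<^bsub>H\<^esub> ((b \<otimes>\<^bsub>H\<^esub> q) \<otimes>\<^bsub>H\<^esub> (?S d \<otimes>\<^bsub>H\<^esub> ?S c))"
    have "sweedler H (\<lambda>y d. sweedler H (\<lambda>p q. ?S p \<otimes>\<^bsub>H\<^esub> (q \<otimes>\<^bsub>H\<^esub> (?S d \<otimes>\<^bsub>H\<^esub> ?S c))) (x \<otimes>\<^bsub>H\<^esub> y)) h =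
        sweedler H (\<lambda>y d. sweedler H (\<lambda>a b. sweedler H (\<lambda>p q. ?T a b p q d) y) x) h"
      by (rule sweedler_cong[OF h], rule sweedler_mult[OF module_H])
        (intro bilinear_mapsI hom_intros cl x c | assumption)+
    \<comment> \<open>The legs of \<open>x\<close> must be fixed outside before coassociativity can
      regroup the sum over \<open>h\<close>.\<close>
    also have "\<dots> = sweedler H (\<lambda>a b. sweedler H (\<lambda>y d. sweedler H (\<lambda>p q. ?T a b p q d) y) h) x"
      by (rule sweedler_swap[OF module_H h x]) (intro sweedler_closed module_H cl x c)
    also have "\<dots> = sweedler H (\<lambda>a b. ?S (a \<otimes>\<^bsub>H\<^esub> h) \<otimes>\<^bsub>H\<^esub> (b \<otimes>\<^bsub>H\<^esub> ?S c)) x"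
    proof (rule sweedler_cong[OF x])
      fix a b assume a: "a \<in> carrier H" and b: "b \<in> carrier H"
      have "sweedler H (\<lambda>y d. sweedler H (\<lambda>p q. ?T a b p q d) y) h =
          sweedler H (\<lambda>p y. sweedler H (\<lambda>q d. ?T a b p q d) y) h"
        by (rule sweedler_coassoc[OF module_H _ h]) (intro trilinearI hom_intros cl a b c)
      also have "\<dots> = sweedler H (\<lambda>p y. counit H y \<odot>\<^bsub>H\<^esub> (?S (a \<otimes>\<^bsub>H\<^esub> p) \<otimes>\<^bsub>H\<^esub> (b \<otimes>\<^bsub>H\<^esub> ?S c))) h"
      proof (rule sweedler_cong[OF h])
        fix p y assume p: "p \<in> carrier H" and y: "y \<in> carrier H"
        have "sweedler H (\<lambda>q d. ?T a b p q d) y =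
            sweedler H (\<lambda>q d. ?S (a \<otimes>\<^bsub>H\<^esub> p) \<otimes>\<^bsub>H\<^esub> (b \<otimes>\<^bsub>H\<^esub> ((q \<otimes>\<^bsub>H\<^esub> ?S d) \<otimes>\<^bsub>H\<^esub> ?S c))) y"
          by (rule sweedler_cong) (simp_all add: cl a b c p y H.m_assoc)
        also have "\<dots> = counit H y \<odot>\<^bsub>H\<^esub> (?S (a \<otimes>\<^bsub>H\<^esub> p) \<otimes>\<^bsub>H\<^esub> (b \<otimes>\<^bsub>H\<^esub> (\<one>\<^bsub>H\<^esub> \<otimes>\<^bsub>H\<^esub> ?S c)))"
          by (rule sweedler_antipode_right[OF module_H _ y]) (intro hom_intros cl a b c p)
        finally show "sweedler H (\<lambda>q d. ?T a b p q d) y =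
            counit H y \<odot>\<^bsub>H\<^esub> (?S (a \<otimes>\<^bsub>H\<^esub> p) \<otimes>\<^bsub>H\<^esub> (b \<otimes>\<^bsub>H\<^esub> ?S c))"
          by (simp add: cl c)
      qed
      also have "\<dots> = ?S (a \<otimes>\<^bsub>H\<^esub> h) \<otimes>\<^bsub>H\<^esub> (b \<otimes>\<^bsub>H\<^esub> ?S c)"
        by (rule sweedler_counit_right[OF module_H _ h]) (intro hom_intros cl a b c)
      finally show "sweedler H (\<lambda>y d. sweedler H (\<lambda>p q. ?T a b p q d) y) h =
        ?S (a \<otimes>\<^bsub>H\<^esub> h) \<otimes>\<^bsub>H\<^esub> (b \<otimes>\<^bsub>H\<^esub> ?S c)" .
    qed
    finally show "sweedler H (\<lambda>y d. sweedler H (\<lambda>p q. ?S p \<otimes>\<^bsub>H\<^esub> (q \<otimes>\<^bsub>H\<^esub> (?S d \<otimes>\<^bsub>H\<^esub> ?S c))) (x \<otimes>\<^bsub>H\<^esub> y)) h =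
      sweedler H (\<lambda>a b. ?S (a \<otimes>\<^bsub>H\<^esub> h) \<otimes>\<^bsub>H\<^esub> (b \<otimes>\<^bsub>H\<^esub> ?S c)) x" .
  qed
  also have "\<dots> = sweedler H (\<lambda>a y. sweedler H (\<lambda>b c. ?S (a \<otimes>\<^bsub>H\<^esub> h) \<otimes>\<^bsub>H\<^esub> (b \<otimes>\<^bsub>H\<^esub> ?S c)) y) g"
    by (rule sweedler_coassoc[OF module_H _ g]) (intro trilinearI hom_intros cl h)
  also have "\<dots> = sweedler H (\<lambda>a y. counit H y \<odot>\<^bsub>H\<^esub> (?S (a \<otimes>\<^bsub>H\<^esub> h) \<otimes>\<^bsub>H\<^esub> \<one>\<^bsub>H\<^esub>)) g"
    by (rule sweedler_cong[OF g], rule sweedler_antipode_right[OF module_H])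
      (intro hom_intros cl h | assumption)+
  also have "\<dots> = ?S (g \<otimes>\<^bsub>H\<^esub> h) \<otimes>\<^bsub>H\<^esub> \<one>\<^bsub>H\<^esub>"
    by (rule sweedler_counit_right[OF module_H _ g]) (intro hom_intros cl h)
  finally show ?thesis
    using 1 by (simp add: cl g h)
qed

text \<open>
  In Sweedler notation, the sum of \<open>G h1 (\<mu> h2 h3) h4\<close> collapses to the sum of \<open>G h1 1 h2\<close>
  whenever \<open>\<mu> h1 h2\<close> sums to \<open>\<epsilon>(h) 1\<close>, as happens for \<open>a S(b)\<close> and \<open>S(a) b\<close>.
\<close>

lemma sweedler_cancel:
  assumes P: "module K P" and G: "trilinear P G" and h: "h \<in> carrier H"
    and \<mu>: "\<mu> \<in> bilinear_maps K H H H"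
    and \<mu>_counit: "\<And>y. y \<in> carrier H \<Longrightarrow> sweedler H \<mu> y = counit H y \<odot>\<^bsub>H\<^esub> \<one>\<^bsub>H\<^esub>"
  shows "sweedler P (\<lambda>a b. sweedler P (\<lambda>c d. sweedler P (\<lambda>e f. G e (\<mu> f c) d) a) b) h =
    sweedler P (\<lambda>e d. G e \<one>\<^bsub>H\<^esub> d) h"
proof -
  note hom = module_hom_ident trilinearD[OF G] bilinear_maps_left[OF \<mu>] bilinear_maps_right[OF \<mu>]
    bilinear_mapsD(1)[OF \<mu>] closed_intros P module_H
  \<comment> \<open>The four legs in order are \<open>e\<close>, \<open>f\<close>, \<open>c\<close>,
    \<open>d\<close>. The first regrouping gathers \<open>e\<close>, \<open>f\<close>,
    \<open>c\<close> under \<open>x\<close>; a second one gathers \<open>f\<close>, \<open>c\<close>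
    under \<open>y\<close>, where \<open>\<mu>_counit\<close> applies.\<close>
  have "sweedler P (\<lambda>a b. sweedler P (\<lambda>c d. sweedler P (\<lambda>e f. G e (\<mu> f c) d) a) b) h =
      sweedler P (\<lambda>x d. sweedler P (\<lambda>a c. sweedler P (\<lambda>e f. G e (\<mu> f c) d) a) x) h"
    by (rule sweedler_coassoc[OF P _ h, symmetric], rule trilinearI)
      ((rule hom_sweedler_arg | rule hom_sweedler | rule bilinear_mapsI | rule hom | assumption)+)
  also have "\<dots> = sweedler P (\<lambda>x d. G x \<one>\<^bsub>H\<^esub> d) h"
  proof (rule sweedler_cong[OF h])
    fix x d assume x: "x \<in> carrier H" and d: "d \<in> carrier H"
    have "sweedler P (\<lambda>a c. sweedler P (\<lambda>e f. G e (\<mu> f c) d) a) x =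
        sweedler P (\<lambda>e y. sweedler P (\<lambda>f c. G e (\<mu> f c) d) y) x"
      by (rule sweedler_coassoc[OF P _ x], rule trilinearI) (rule hom d | assumption)+
    also have "\<dots> = sweedler P (\<lambda>e y. counit H y \<odot>\<^bsub>P\<^esub> G e \<one>\<^bsub>H\<^esub> d) x"
    proof (rule sweedler_cong[OF x])
      fix e y assume e: "e \<in> carrier H" and y: "y \<in> carrier H"
      have Ge: "(\<lambda>v. G e v d) \<in> module_hom K H P"
        by (rule hom d e)+
      have "sweedler P (\<lambda>f c. G e (\<mu> f c) d) y = G e (sweedler H \<mu> y) d"
        by (rule sweedler_module_hom[OF module_H P Ge y, symmetric]) (rule hom | assumption)+
      then show "sweedler P (\<lambda>f c. G e (\<mu> f c) d) y = counit H y \<odot>\<^bsub>P\<^esub> G e \<one>\<^bsub>H\<^esub> d"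
        using module_hom_smult[OF Ge] by (simp add: \<mu>_counit y counit_closed)
    qed
    also have "\<dots> = G x \<one>\<^bsub>H\<^esub> d"
      by (rule sweedler_counit_right[OF P _ x]) (rule hom d)+
    finally show "sweedler P (\<lambda>a c. sweedler P (\<lambda>e f. G e (\<mu> f c) d) a) x = G x \<one>\<^bsub>H\<^esub> d" .
  qed
  finally show ?thesis .
qed

lemma sweedler_cancel_right:
  assumes "module K P" "trilinear P G" "h \<in> carrier H"
  shows "sweedler P (\<lambda>a b. sweedler P (\<lambda>c d. sweedler P (\<lambda>e f. G e (f \<otimes>\<^bsub>H\<^esub> antipode H c) d) a) b) h =
    sweedler P (\<lambda>e d. G e \<one>\<^bsub>H\<^esub> d) h"
  by (rule sweedler_cancel[OF assms])
    (intro bilinear_mapsI hom_intros closed_intros antipode_right | assumption)+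

lemma sweedler_cancel_left:
  assumes "module K P" "trilinear P G" "h \<in> carrier H"
  shows "sweedler P (\<lambda>a b. sweedler P (\<lambda>c d. sweedler P (\<lambda>e f. G e (antipode H f \<otimes>\<^bsub>H\<^esub> c) d) a) b) h =
    sweedler P (\<lambda>e d. G e \<one>\<^bsub>H\<^esub> d) h"
  by (rule sweedler_cancel[OF assms])
    (intro bilinear_mapsI hom_intros closed_intros antipode_left | assumption)+

end


section \<open>The antipode and equivariant modules\<close>

context left_H_module
begin

lemma module_V: "module K V"
  by (rule vectorspace.axioms(1)[OF V.vectorspace_axioms])

lemma act_closed: "h \<in> carrier H \<Longrightarrow> v \<in> carrier V \<Longrightarrow> act h v \<in> carrier V"
  by (rule bilinear_mapsD(1)[OF act_bilinear])

lemma hom_act_left: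
  "f \<in> module_hom K L H \<Longrightarrow> v \<in> carrier V \<Longrightarrow> (\<lambda>x. act (f x) v) \<in> module_hom K L V"
  by (rule bilinear_maps_left[OF act_bilinear])

lemma hom_act_right:
  "f \<in> module_hom K L V \<Longrightarrow> h \<in> carrier H \<Longrightarrow> (\<lambda>x. act h (f x)) \<in> module_hom K L V"
  by (rule bilinear_maps_right[OF act_bilinear])

text \<open>Together with \<open>act_antipode_right\<close>: acting through the antipode is the
  two-sided convolution inverse of the action.\<close>

lemma act_antipode_left:
  assumes "h \<in> carrier H" "v \<in> carrier V"
  shows "sweedler V (\<lambda>a b. act (antipode H a) (act b v)) h = counit H h \<odot>\<^bsub>V\<^esub> v"
proof -
  have "sweedler V (\<lambda>a b. act (antipode H a) (act b v)) h =
      sweedler V (\<lambda>a b. act (antipode H a \<otimes>\<^bsub>H\<^esub> b) v) h"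
    by (rule sweedler_cong[OF assms(1)]) (simp add: act_mult antipode_closed assms(2))
  also have "\<dots> = counit H h \<odot>\<^bsub>V\<^esub> act \<one>\<^bsub>H\<^esub> v"
    by (rule sweedler_antipode_left[OF module_V _ assms(1)]) (intro hom_act_left hom_intros assms(2))
  finally show ?thesis by (simp add: act_one assms(2))
qed

lemma act_antipode_right:
  assumes "h \<in> carrier H" "v \<in> carrier V"
  shows "sweedler V (\<lambda>a b. act a (act (antipode H b) v)) h = counit H h \<odot>\<^bsub>V\<^esub> v"
proof -
  have "sweedler V (\<lambda>a b. act a (act (antipode H b) v)) h =
      sweedler V (\<lambda>a b. act (a \<otimes>\<^bsub>H\<^esub> antipode H b) v) h"
    by (rule sweedler_cong[OF assms(1)]) (simp add: act_mult antipode_closed assms(2))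
  also have "\<dots> = counit H h \<odot>\<^bsub>V\<^esub> act \<one>\<^bsub>H\<^esub> v"
    by (rule sweedler_antipode_right[OF module_V _ assms(1)]) (intro hom_act_left hom_intros assms(2))
  finally show ?thesis by (simp add: act_one assms(2))
qed

end

section \<open>Cancellation in an equivariant module\<close>

context equivariant_right_module
begin

text \<open>Equivariance produces \<open>h2 S(h3)\<close> on \<open>f\<close>, and this pair
  cancels. The linear map \<open>w\<close> is left open for two uses: \<open>w(d) = S(d) m\<close>
  here in \<open>antipode_equivariant\<close>, and \<open>w(d) = \<eta>(S(d) m)\<close> for
  naturality of the action on morphisms.\<close>

lemma sweedler_act_map:
  assumes X: "X \<in> Obj C" and Y: "Y \<in> Obj C" and h: "h \<in> carrier H"
    and f: "f \<in> carrier (Hom C X Y)" and w: "w \<in> module_hom K H (mod_at M Y)"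
  shows "sweedler (mod_at M X) (\<lambda>a b. mod_act M X a
      (sweedler (mod_at M X) (\<lambda>c d. mod_map M X Y (act X Y (antipode H c) f) (w d)) b)) h =
    mod_map M X Y f (sweedler (mod_at M Y) (\<lambda>a b. mod_act M Y a (w b)) h)"
proof -
  interpret MX: left_H_module K H "mod_at M X" "mod_act M X" by (rule mod_H_module[OF X])
  interpret MY: left_H_module K H "mod_at M Y" "mod_act M Y" by (rule mod_H_module[OF Y])
  interpret XY: left_H_module K H "Hom C X Y" "act X Y" by (rule Hom_H_module[OF X Y])
  note map = mod_map_bilinear[OF X Y]
  note cl = closed_intros MX.act_closed MY.act_closed XY.act_closed bilinear_mapsD(1)[OF map] f
    module_hom_mem[OF w]
  note hom = hom_intros module_hom_comp[OF w] MX.hom_act_left MX.hom_act_right MY.hom_act_left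
    MY.hom_act_right XY.hom_act_left XY.hom_act_right bilinear_maps_left[OF map]
    bilinear_maps_right[OF map]
  let ?MX = "mod_at M X" and ?MY = "mod_at M Y" and ?S = "antipode H"
  have "sweedler ?MX (\<lambda>a b. mod_act M X a
        (sweedler ?MX (\<lambda>c d. mod_map M X Y (act X Y (?S c) f) (w d)) b)) h =
      sweedler ?MX (\<lambda>a b. sweedler ?MX (\<lambda>c d. sweedler ?MX (\<lambda>e g.
        mod_map M X Y (act X Y (g \<otimes>\<^bsub>H\<^esub> ?S c) f) (mod_act M Y e (w d))) a) b) h"
  proof (rule sweedler_cong[OF h])
    fix a b assume a: "a \<in> carrier H" and b: "b \<in> carrier H"
    have "mod_act M X a (sweedler ?MX (\<lambda>c d. mod_map M X Y (act X Y (?S c) f) (w d)) b) =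
        sweedler ?MX (\<lambda>c d. mod_act M X a (mod_map M X Y (act X Y (?S c) f) (w d))) b"
      by (rule sweedler_module_hom[OF MX.module_V MX.module_V _ b]) (rule hom cl a | assumption)+
    also have "\<dots> = sweedler ?MX (\<lambda>c d. sweedler ?MX (\<lambda>e g.
        mod_map M X Y (act X Y (g \<otimes>\<^bsub>H\<^esub> ?S c) f) (mod_act M Y e (w d))) a) b"
    proof (rule sweedler_cong[OF b])
      fix c d assume c: "c \<in> carrier H" and d: "d \<in> carrier H"
      \<comment> \<open>The first leg \<open>e\<close> of \<open>a\<close> goes to the module
        element and the second leg \<open>g\<close> to the morphism, so \<open>g\<close> lands next
        to \<open>?S c\<close>.\<close>
      have "mod_act M X a (mod_map M X Y (act X Y (?S c) f) (w d)) =
          sweedler ?MX (\<lambda>e g. mod_map M X Y (act X Y g (act X Y (?S c) f)) (mod_act M Y e (w d))) a"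
        by (rule equivariant[OF X Y a]) (intro cl c d)+
      also have "\<dots> = sweedler ?MX (\<lambda>e g.
          mod_map M X Y (act X Y (g \<otimes>\<^bsub>H\<^esub> ?S c) f) (mod_act M Y e (w d))) a"
        by (rule sweedler_cong[OF a]) (simp add: XY.act_mult cl c)
      finally show "mod_act M X a (mod_map M X Y (act X Y (?S c) f) (w d)) =
        sweedler ?MX (\<lambda>e g.
          mod_map M X Y (act X Y (g \<otimes>\<^bsub>H\<^esub> ?S c) f) (mod_act M Y e (w d))) a" .
    qed
    finally show "mod_act M X a (sweedler ?MX (\<lambda>c d. mod_map M X Y (act X Y (?S c) f) (w d)) b) =
      sweedler ?MX (\<lambda>c d. sweedler ?MX (\<lambda>e g.
        mod_map M X Y (act X Y (g \<otimes>\<^bsub>H\<^esub> ?S c) f) (mod_act M Y e (w d))) a) b" .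
  qed
  also have "\<dots> = sweedler ?MX (\<lambda>e d. mod_map M X Y (act X Y \<one>\<^bsub>H\<^esub> f) (mod_act M Y e (w d))) h"
    by (rule sweedler_cancel_right[OF MX.module_V _ h,
          where G = "\<lambda>e v d. mod_map M X Y (act X Y v f) (mod_act M Y e (w d))"])
      (rule trilinearI; (rule hom cl | assumption)+)
  also have "\<dots> = sweedler ?MX (\<lambda>e d. mod_map M X Y f (mod_act M Y e (w d))) h"
    by (simp add: XY.act_one f)
  also have "\<dots> = mod_map M X Y f (sweedler ?MY (\<lambda>e d. mod_act M Y e (w d)) h)"
    by (rule sweedler_module_hom[OF MY.module_V MX.module_V _ h, symmetric]) (rule hom cl | assumption)+
  finally show ?thesis .
qed

text \<open>
  As the antipode reverses the comultiplication, this is equivariance at \<open>S(h)\<close>. It is obtained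
  without that fact: the convolution with \<open>h \<mapsto> (m \<mapsto> h m)\<close> turns both sides into
  \<open>h \<mapsto> \<epsilon>(h) M(f)(m)\<close>, and it is undone by the convolution with \<open>h \<mapsto> (m \<mapsto> S(h) m)\<close>.
\<close>

lemma antipode_equivariant:
  assumes X: "X \<in> Obj C" and Y: "Y \<in> Obj C" and h: "h \<in> carrier H"
    and f: "f \<in> carrier (Hom C X Y)" and m: "m \<in> carrier (mod_at M Y)"
  shows "mod_act M X (antipode H h) (mod_map M X Y f m) =
    sweedler (mod_at M X)
      (\<lambda>a b. mod_map M X Y (act X Y (antipode H a) f) (mod_act M Y (antipode H b) m)) h"
proof -
  interpret MX: left_H_module K H "mod_at M X" "mod_act M X" by (rule mod_H_module[OF X])
  interpret MY: left_H_module K H "mod_at M Y" "mod_act M Y" by (rule mod_H_module[OF Y])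
  interpret XY: left_H_module K H "Hom C X Y" "act X Y" by (rule Hom_H_module[OF X Y])
  note map = mod_map_bilinear[OF X Y]
  let ?MX = "mod_at M X" and ?MY = "mod_at M Y" and ?S = "antipode H"
  let ?n = "mod_map M X Y f m"
  \<comment> \<open>This is the claimed right-hand side as a function of \<open>h\<close>. Its
    linearity allows it to occur as one leg of further sums.\<close>
  define R where "R = sweedler ?MX
    (\<lambda>a b. mod_map M X Y (act X Y (?S a) f) (mod_act M Y (?S b) m))"
  note cl = closed_intros MX.act_closed MY.act_closed XY.act_closed bilinear_mapsD(1)[OF map] f m
  note hom = hom_intros MX.hom_act_left MX.hom_act_right MY.hom_act_left
    MY.hom_act_right XY.hom_act_left XY.hom_act_right bilinear_maps_left[OF map]
    bilinear_maps_right[OF map]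
  have R: "R \<in> module_hom K H ?MX"
    unfolding R_def
    by (rule hom_sweedler_arg[OF MX.module_V _ module_hom_ident])
      (rule bilinear_mapsI; (rule hom cl | assumption)+)
  note homR = hom module_hom_comp[OF R]
  note clR = cl module_hom_mem[OF R]
  \<comment> \<open>Once \<open>sweedler_act_map\<close> has removed the action on \<open>f\<close>,
    the sum of \<open>h1 S(h2) m\<close> is left under \<open>M(f)\<close> and collapses to
    \<open>\<epsilon>(h) m\<close>.\<close>
  have inv: "sweedler ?MX (\<lambda>a b. mod_act M X a (R b)) x = counit H x \<odot>\<^bsub>?MX\<^esub> ?n"
    if x: "x \<in> carrier H" for x
  proof -
    have "sweedler ?MX (\<lambda>a b. mod_act M X a (R b)) x =
        mod_map M X Y f (sweedler ?MY (\<lambda>a b. mod_act M Y a (mod_act M Y (?S b) m)) x)"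
      unfolding R_def by (rule sweedler_act_map[OF X Y x f]) (rule hom cl)+
    also have "\<dots> = counit H x \<odot>\<^bsub>?MX\<^esub> ?n"
      by (simp add: MY.act_antipode_right x m f counit_closed bilinear_mapsD(5)[OF map])
    finally show ?thesis .
  qed
  \<comment> \<open>A counit is inserted at the leg \<open>b\<close> so that \<open>inv\<close> can
    trade it for a sum containing \<open>R\<close>; after regrouping, \<open>?S a\<close> cancels
    against \<open>c\<close>.\<close>
  have "mod_act M X (?S h) ?n = sweedler ?MX (\<lambda>a b. counit H b \<odot>\<^bsub>?MX\<^esub> mod_act M X (?S a) ?n) h"
    by (rule sweedler_counit_right[OF MX.module_V _ h, symmetric]) (rule hom cl)+
  also have "\<dots> = sweedler ?MX (\<lambda>a b. sweedler ?MX (\<lambda>c d. mod_act M X (?S a) (mod_act M X c (R d))) b) h"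
  proof (rule sweedler_cong[OF h])
    fix a b assume a: "a \<in> carrier H" and b: "b \<in> carrier H"
    have "counit H b \<odot>\<^bsub>?MX\<^esub> mod_act M X (?S a) ?n = mod_act M X (?S a) (counit H b \<odot>\<^bsub>?MX\<^esub> ?n)"
      by (simp add: bilinear_mapsD(5)[OF MX.act_bilinear] cl counit_closed a b)
    also have "\<dots> = mod_act M X (?S a) (sweedler ?MX (\<lambda>c d. mod_act M X c (R d)) b)"
      by (simp only: inv[OF b])
    also have "\<dots> = sweedler ?MX (\<lambda>c d. mod_act M X (?S a) (mod_act M X c (R d))) b"
      by (rule sweedler_module_hom[OF MX.module_V MX.module_V _ b]) (rule hom clR a | assumption)+
    finally show "counit H b \<odot>\<^bsub>?MX\<^esub> mod_act M X (?S a) ?n =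
      sweedler ?MX (\<lambda>c d. mod_act M X (?S a) (mod_act M X c (R d))) b" .
  qed
  also have "\<dots> = sweedler ?MX (\<lambda>x d. sweedler ?MX (\<lambda>a c. mod_act M X (?S a) (mod_act M X c (R d))) x) h"
    by (rule sweedler_coassoc[OF MX.module_V _ h, symmetric])
      (rule trilinearI; (rule homR clR | assumption)+)
  also have "\<dots> = sweedler ?MX (\<lambda>x d. counit H x \<odot>\<^bsub>?MX\<^esub> R d) h"
    by (rule sweedler_cong[OF h]) (simp add: MX.act_antipode_left clR)
  also have "\<dots> = R h"
    by (rule sweedler_counit_left[OF MX.module_V R h])
  finally show ?thesis unfolding R_def .
qed

end


section \<open>Morphisms of right modules\<close>

lemma nat_family_apply [simp]:
  "X \<in> Obj C \<Longrightarrow> m \<in> carrier (mod_at M X) \<Longrightarrow> nat_family C M \<eta> X m = \<eta> X m"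
  unfolding nat_family_def by simp

text \<open>Morphisms are extensional both in objects and in elements, so agreement on objects and
  carriers is enough.\<close>

lemma rmod_hom_eqI:
  assumes "\<eta> \<in> carrier (rmod_hom K C M N)" "\<theta> \<in> carrier (rmod_hom K C M N)"
    and "\<And>X m. X \<in> Obj C \<Longrightarrow> m \<in> carrier (mod_at M X) \<Longrightarrow> \<eta> X m = \<theta> X m"
  shows "\<eta> = \<theta>"
proof (rule extensionalityI[of _ "Obj C"])
  fix X assume X: "X \<in> Obj C"
  show "\<eta> X = \<theta> X"
    by (rule extensionalityI[of _ "carrier (mod_at M X)"])
      (use assms X in \<open>auto simp: rmod_hom_def\<close>)
qed (use assms in \<open>auto simp: rmod_hom_def\<close>)

lemma rmod_hom_linear:
  "\<eta> \<in> carrier (rmod_hom K C M N) \<Longrightarrow> X \<in> Obj C \<Longrightarrow>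
    \<eta> X \<in> module_hom K (mod_at M X) (mod_at N X)"
  unfolding rmod_hom_def by auto

lemma rmod_hom_natural:
  "\<eta> \<in> carrier (rmod_hom K C M N) \<Longrightarrow> X \<in> Obj C \<Longrightarrow> Y \<in> Obj C \<Longrightarrow>
    f \<in> carrier (Hom C X Y) \<Longrightarrow> m \<in> carrier (mod_at M Y) \<Longrightarrow>
    \<eta> X (mod_map M X Y f m) = mod_map N X Y f (\<eta> Y m)"
  unfolding rmod_hom_def by auto

lemma rmod_hom_closed:
  "\<eta> \<in> carrier (rmod_hom K C M N) \<Longrightarrow> X \<in> Obj C \<Longrightarrow> m \<in> carrier (mod_at M X) \<Longrightarrow>
    \<eta> X m \<in> carrier (mod_at N X)"
  by (rule module_hom_mem[OF rmod_hom_linear])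

lemma rmod_hom_ops [simp]:
  assumes "X \<in> Obj C" "m \<in> carrier (mod_at M X)"
  shows "(\<eta> \<oplus>\<^bsub>rmod_hom K C M N\<^esub> \<theta>) X m = \<eta> X m \<oplus>\<^bsub>mod_at N X\<^esub> \<theta> X m"
    and "(c \<odot>\<^bsub>rmod_hom K C M N\<^esub> \<eta>) X m = c \<odot>\<^bsub>mod_at N X\<^esub> \<eta> X m"
    and "\<zero>\<^bsub>rmod_hom K C M N\<^esub> X m = \<zero>\<^bsub>mod_at N X\<^esub>"
  using assms unfolding rmod_hom_def by simp_all

lemma (in right_module) module_at: "X \<in> Obj C \<Longrightarrow> module K (mod_at M X)"
  by (rule vectorspace.axioms(1)[OF mod_vectorspace])

lemma (in right_module) map_closed:
  "X \<in> Obj C \<Longrightarrow> Y \<in> Obj C \<Longrightarrow> f \<in> carrier (Hom C X Y) \<Longrightarrow> m \<in> carrier (mod_at M Y) \<Longrightarrow>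
    mod_map M X Y f m \<in> carrier (mod_at M X)"
  by (rule bilinear_mapsD(1)[OF mod_map_bilinear])

text \<open>The maps \<open>M(f)\<close> stay in the carriers, so the restriction by
  \<open>nat_family\<close> is invisible to linearity and naturality. Morphisms defined by a formula
  on elements enter \<open>rmod_hom\<close> this way.\<close>

lemma (in right_module) nat_family_in_rmod_hom:
  assumes lin: "\<And>X. X \<in> Obj C \<Longrightarrow> (\<lambda>m. \<eta> X m) \<in> module_hom K (mod_at M X) (mod_at N X)"
    and nat: "\<And>X Y f m. X \<in> Obj C \<Longrightarrow> Y \<in> Obj C \<Longrightarrow> f \<in> carrier (Hom C X Y) \<Longrightarrow>
      m \<in> carrier (mod_at M Y) \<Longrightarrow> \<eta> X (mod_map M X Y f m) = mod_map N X Y f (\<eta> Y m)"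
  shows "nat_family C M \<eta> \<in> carrier (rmod_hom K C M N)"
proof -
  have "nat_family C M \<eta> X \<in> module_hom K (mod_at M X) (mod_at N X)" if X: "X \<in> Obj C" for X
    by (rule module_hom_cong[OF lin[OF X] _ module_at[OF X]]) (simp add: X)
  moreover have "nat_family C M \<eta> X (mod_map M X Y f m) = mod_map N X Y f (nat_family C M \<eta> Y m)"
    if "X \<in> Obj C" "Y \<in> Obj C" "f \<in> carrier (Hom C X Y)" "m \<in> carrier (mod_at M Y)" for X Y f m
    using that by (simp add: map_closed nat)
  ultimately show ?thesis
    unfolding rmod_hom_def by (auto simp: nat_family_def)
qed

section \<open>The vector space of morphisms between two right modules\<close>

locale right_module_pair = M: right_module K C M + N: right_module K C N
  for K :: "('k, 'z) ring_scheme" and C :: "('o, 'm, 'k) lincat"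
    and M :: "('o, 'm, 'k, 'v, 'y) rmod_scheme" and N :: "('o, 'm, 'k, 'v, 'y) rmod_scheme"
begin

lemmas eqI = rmod_hom_eqI[where K = K and C = C and M = M and N = N]

lemma rmod_hom_add_closed:
  assumes \<eta>: "\<eta> \<in> carrier (rmod_hom K C M N)" and \<theta>: "\<theta> \<in> carrier (rmod_hom K C M N)"
  shows "\<eta> \<oplus>\<^bsub>rmod_hom K C M N\<^esub> \<theta> \<in> carrier (rmod_hom K C M N)"
proof -
  have "nat_family C M (\<lambda>X m. \<eta> X m \<oplus>\<^bsub>mod_at N X\<^esub> \<theta> X m) \<in> carrier (rmod_hom K C M N)"
  proof (rule M.nat_family_in_rmod_hom)
    fix X assume X: "X \<in> Obj C"
    interpret NX: module K "mod_at N X" by (rule N.module_at[OF X])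
    note h = rmod_hom_linear[OF \<eta> X] rmod_hom_linear[OF \<theta> X]
    note cl = h[THEN module_hom_mem]
    show "(\<lambda>m. \<eta> X m \<oplus>\<^bsub>mod_at N X\<^esub> \<theta> X m) \<in> module_hom K (mod_at M X) (mod_at N X)"
      by (rule module_homI)
        (simp_all add: cl h[THEN module_hom_add] h[THEN module_hom_smult] NX.smult_r_distr NX.a_ac)
  next
    fix X Y f m assume X: "X \<in> Obj C" and Y: "Y \<in> Obj C" and f: "f \<in> carrier (Hom C X Y)"
      and m: "m \<in> carrier (mod_at M Y)"
    then show "\<eta> X (mod_map M X Y f m) \<oplus>\<^bsub>mod_at N X\<^esub> \<theta> X (mod_map M X Y f m) =
        mod_map N X Y f (\<eta> Y m \<oplus>\<^bsub>mod_at N Y\<^esub> \<theta> Y m)"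
      by (simp add: rmod_hom_natural[OF \<eta>] rmod_hom_natural[OF \<theta>] rmod_hom_closed[OF \<eta>]
          rmod_hom_closed[OF \<theta>] bilinear_mapsD(3)[OF N.mod_map_bilinear[OF X Y]])
  qed
  then show ?thesis by (simp add: rmod_hom_def)
qed

lemma rmod_hom_smult_closed:
  assumes \<eta>: "\<eta> \<in> carrier (rmod_hom K C M N)" and c: "c \<in> carrier K"
  shows "c \<odot>\<^bsub>rmod_hom K C M N\<^esub> \<eta> \<in> carrier (rmod_hom K C M N)"
proof -
  have "nat_family C M (\<lambda>X m. c \<odot>\<^bsub>mod_at N X\<^esub> \<eta> X m) \<in> carrier (rmod_hom K C M N)"
  proof (rule M.nat_family_in_rmod_hom)
    fix X assume X: "X \<in> Obj C"
    interpret NX: module K "mod_at N X" by (rule N.module_at[OF X])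
    note h = rmod_hom_linear[OF \<eta> X]
    note cl = h[THEN module_hom_mem]
    show "(\<lambda>m. c \<odot>\<^bsub>mod_at N X\<^esub> \<eta> X m) \<in> module_hom K (mod_at M X) (mod_at N X)"
      by (rule module_homI)
        (simp_all add: cl h[THEN module_hom_add] h[THEN module_hom_smult] NX.smult_r_distr c
          NX.smult_assoc1[symmetric] M.m_comm)
  next
    fix X Y f m assume X: "X \<in> Obj C" and Y: "Y \<in> Obj C" and f: "f \<in> carrier (Hom C X Y)"
      and m: "m \<in> carrier (mod_at M Y)"
    then show "c \<odot>\<^bsub>mod_at N X\<^esub> \<eta> X (mod_map M X Y f m) =
        mod_map N X Y f (c \<odot>\<^bsub>mod_at N Y\<^esub> \<eta> Y m)"
      by (simp add: rmod_hom_natural[OF \<eta>] rmod_hom_closed[OF \<eta>] c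
          bilinear_mapsD(5)[OF N.mod_map_bilinear[OF X Y]])
  qed
  then show ?thesis by (simp add: rmod_hom_def)
qed

lemma rmod_hom_zero_closed: "\<zero>\<^bsub>rmod_hom K C M N\<^esub> \<in> carrier (rmod_hom K C M N)"
proof -
  have "nat_family C M (\<lambda>X m. \<zero>\<^bsub>mod_at N X\<^esub>) \<in> carrier (rmod_hom K C M N)"
  proof (rule M.nat_family_in_rmod_hom)
    fix X assume X: "X \<in> Obj C"
    interpret NX: module K "mod_at N X" by (rule N.module_at[OF X])
    show "(\<lambda>m. \<zero>\<^bsub>mod_at N X\<^esub>) \<in> module_hom K (mod_at M X) (mod_at N X)"
      by (rule module_homI) simp_all
  next
    fix X Y f assume X: "X \<in> Obj C" and Y: "Y \<in> Obj C" and f: "f \<in> carrier (Hom C X Y)"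
    show "\<zero>\<^bsub>mod_at N X\<^esub> = mod_map N X Y f \<zero>\<^bsub>mod_at N Y\<^esub>"
      by (rule module_hom_zero[OF N.module_at[OF Y] N.module_at[OF X], symmetric],
          rule bilinear_maps_right[OF N.mod_map_bilinear[OF X Y] module_hom_ident f])
  qed
  then show ?thesis by (simp add: rmod_hom_def)
qed

lemma vectorspace_rmod_hom: "vectorspace K (rmod_hom K C M N)"
proof -
  let ?R = "rmod_hom K C M N"
  note cl = rmod_hom_add_closed rmod_hom_smult_closed rmod_hom_zero_closed
  note NM = N.module_at
  note ag = abelian_group.axioms(1)[OF module.axioms(2)[OF N.module_at]]
  have "module K ?R"
  proof (rule moduleI)
    show "abelian_group ?R"
    proof (rule abelian_groupI)
      fix \<eta> \<theta> \<zeta> assume c: "\<eta> \<in> carrier ?R" "\<theta> \<in> carrier ?R" "\<zeta> \<in> carrier ?R"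
      show "\<eta> \<oplus>\<^bsub>?R\<^esub> \<theta> \<oplus>\<^bsub>?R\<^esub> \<zeta> = \<eta> \<oplus>\<^bsub>?R\<^esub> (\<theta> \<oplus>\<^bsub>?R\<^esub> \<zeta>)"
        by (rule eqI) (simp_all add: cl c c[THEN rmod_hom_closed] abelian_monoid.a_assoc[OF ag])
    next
      fix \<eta> \<theta> assume c: "\<eta> \<in> carrier ?R" "\<theta> \<in> carrier ?R"
      show "\<eta> \<oplus>\<^bsub>?R\<^esub> \<theta> = \<theta> \<oplus>\<^bsub>?R\<^esub> \<eta>"
        by (rule eqI) (simp_all add: cl c c[THEN rmod_hom_closed] abelian_monoid.a_comm[OF ag])
    next
      fix \<eta> assume c: "\<eta> \<in> carrier ?R"
      show "\<zero>\<^bsub>?R\<^esub> \<oplus>\<^bsub>?R\<^esub> \<eta> = \<eta>"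
        by (rule eqI) (simp_all add: cl c c[THEN rmod_hom_closed] abelian_monoid.l_zero[OF ag])
      have m: "\<ominus>\<^bsub>K\<^esub> \<one>\<^bsub>K\<^esub> \<in> carrier K" by simp
      \<comment> \<open>The negative is obtained as the multiple by \<open>-1\<close>, which is
        already known to be a morphism.\<close>
      have "(\<ominus>\<^bsub>K\<^esub> \<one>\<^bsub>K\<^esub>) \<odot>\<^bsub>?R\<^esub> \<eta> \<oplus>\<^bsub>?R\<^esub> \<eta> = \<zero>\<^bsub>?R\<^esub>"
      proof (rule eqI)
        fix X m assume X: "X \<in> Obj C" and m: "m \<in> carrier (mod_at M X)"
        interpret NX: module K "mod_at N X" by (rule N.module_at[OF X])
        have "(\<ominus>\<^bsub>K\<^esub> \<one>\<^bsub>K\<^esub>) \<odot>\<^bsub>mod_at N X\<^esub> \<eta> X m = \<ominus>\<^bsub>mod_at N X\<^esub> \<eta> X m"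
          by (rule NX.smult_minus_1) (rule rmod_hom_closed[OF c X m])
        then show "((\<ominus>\<^bsub>K\<^esub> \<one>\<^bsub>K\<^esub>) \<odot>\<^bsub>?R\<^esub> \<eta> \<oplus>\<^bsub>?R\<^esub> \<eta>) X m = \<zero>\<^bsub>?R\<^esub> X m"
          using rmod_hom_closed[OF c X m] by (simp add: X m NX.l_neg)
      qed (simp_all add: cl c)
      then show "\<exists>\<theta>\<in>carrier ?R. \<theta> \<oplus>\<^bsub>?R\<^esub> \<eta> = \<zero>\<^bsub>?R\<^esub>"
        using rmod_hom_smult_closed[OF c m] by blast
    qed (simp_all add: cl)
    show "cring K" by (rule M.is_cring)
  next
    fix a b \<eta> assume ab: "a \<in> carrier K" "b \<in> carrier K" and c: "\<eta> \<in> carrier ?R"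
    show "(a \<oplus>\<^bsub>K\<^esub> b) \<odot>\<^bsub>?R\<^esub> \<eta> = a \<odot>\<^bsub>?R\<^esub> \<eta> \<oplus>\<^bsub>?R\<^esub> b \<odot>\<^bsub>?R\<^esub> \<eta>"
      by (rule eqI)
        (simp_all add: cl c ab rmod_hom_closed[OF c] module.smult_l_distr[OF NM])
    show "(a \<otimes>\<^bsub>K\<^esub> b) \<odot>\<^bsub>?R\<^esub> \<eta> = a \<odot>\<^bsub>?R\<^esub> (b \<odot>\<^bsub>?R\<^esub> \<eta>)"
      by (rule eqI)
        (simp_all add: cl c ab rmod_hom_closed[OF c] module.smult_assoc1[OF NM])
  next
    fix a \<eta> \<theta> assume a: "a \<in> carrier K" and c: "\<eta> \<in> carrier ?R" "\<theta> \<in> carrier ?R"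
    show "a \<odot>\<^bsub>?R\<^esub> (\<eta> \<oplus>\<^bsub>?R\<^esub> \<theta>) = a \<odot>\<^bsub>?R\<^esub> \<eta> \<oplus>\<^bsub>?R\<^esub> a \<odot>\<^bsub>?R\<^esub> \<theta>"
      by (rule eqI)
        (simp_all add: cl c a c[THEN rmod_hom_closed] module.smult_r_distr[OF NM])
  next
    fix \<eta> assume c: "\<eta> \<in> carrier ?R"
    show "\<one>\<^bsub>K\<^esub> \<odot>\<^bsub>?R\<^esub> \<eta> = \<eta>"
      by (rule eqI) (simp_all add: cl c rmod_hom_closed[OF c] module.smult_one[OF NM])
  qed (rule rmod_hom_smult_closed)
  then show ?thesis
    by (intro vectorspace.intro M.field_axioms)
qed

lemma module_rmod_hom: "module K (rmod_hom K C M N)"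
  by (rule vectorspace.axioms(1)[OF vectorspace_rmod_hom])

lemma hom_eval:
  assumes "f \<in> module_hom K L (rmod_hom K C M N)" "X \<in> Obj C" "m \<in> carrier (mod_at M X)"
  shows "(\<lambda>x. f x X m) \<in> module_hom K L (mod_at N X)"
proof -
  have "(\<lambda>\<eta>. \<eta> X m) \<in> module_hom K (rmod_hom K C M N) (mod_at N X)"
    by (rule module_homI) (simp_all add: assms(2,3) rmod_hom_closed[where K = K and C = C and M = M])
  from module_hom_comp[OF this assms(1)] show ?thesis .
qed

text \<open>The operations on morphisms are pointwise, so linearity can be tested by evaluation.
  With \<open>hom_eval\<close> this reduces bilinearity of the action and of composition to
  statements about the values of the modules.\<close>

lemma hom_rmod_homI:
  assumes L: "module K L" and cl: "\<And>x. x \<in> carrier L \<Longrightarrow> f x \<in> carrier (rmod_hom K C M N)"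
    and lin: "\<And>X m. X \<in> Obj C \<Longrightarrow> m \<in> carrier (mod_at M X) \<Longrightarrow>
      (\<lambda>x. f x X m) \<in> module_hom K L (mod_at N X)"
  shows "f \<in> module_hom K L (rmod_hom K C M N)"
proof -
  interpret L: module K L by fact
  show ?thesis
  proof (rule module_homI[OF cl])
    fix x y assume x: "x \<in> carrier L" and y: "y \<in> carrier L"
    show "f (x \<oplus>\<^bsub>L\<^esub> y) = f x \<oplus>\<^bsub>rmod_hom K C M N\<^esub> f y"
      by (rule eqI)
        (simp_all add: cl x y rmod_hom_add_closed module_hom_add[OF lin])
  next
    fix c x assume c: "c \<in> carrier K" and x: "x \<in> carrier L"
    show "f (c \<odot>\<^bsub>L\<^esub> x) = c \<odot>\<^bsub>rmod_hom K C M N\<^esub> f x"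
      by (rule eqI)
        (simp_all add: cl x c rmod_hom_smult_closed module_hom_smult[OF lin])
  qed
qed

end

section \<open>The action of the Hopf algebra on morphisms\<close>

lemma rmod_hom_act_apply [simp]:
  "X \<in> Obj C \<Longrightarrow> m \<in> carrier (mod_at M X) \<Longrightarrow> rmod_hom_act H C M N h \<eta> X m =
    tensor_lift (mod_at N X) (\<lambda>a b. mod_act N X a (\<eta> X (mod_act M X (antipode H b) m))) (comult H h)"
  unfolding rmod_hom_act_def by simp

locale equivariant_pair = left_H_category K H C act +
  M: equivariant_right_module K H C act M + N: equivariant_right_module K H C act N
  for K :: "('k, 'z) ring_scheme" and H :: "('k, 'h) hopf" and C :: "('o, 'm, 'k) lincat"
    and act :: "'o \<Rightarrow> 'o \<Rightarrow> 'h \<Rightarrow> 'm \<Rightarrow> 'm"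
    and M :: "('o, 'm, 'k, 'v, 'h) eqrmod" and N :: "('o, 'm, 'k, 'v, 'h) eqrmod"
begin

sublocale right_module_pair K C M N
  by (intro right_module_pair.intro M.right_module_axioms N.right_module_axioms)

lemma rmod_hom_act_closed:
  assumes h: "h \<in> carrier H" and \<eta>: "\<eta> \<in> carrier (rmod_hom K C M N)"
  shows "rmod_hom_act H C M N h \<eta> \<in> carrier (rmod_hom K C M N)"
  unfolding rmod_hom_act_def
proof (rule M.nat_family_in_rmod_hom)
  fix X assume X: "X \<in> Obj C"
  interpret MX: left_H_module K H "mod_at M X" "mod_act M X" by (rule M.mod_H_module[OF X])
  interpret NX: left_H_module K H "mod_at N X" "mod_act N X" by (rule N.mod_H_module[OF X])
  show "(\<lambda>m. sweedler (mod_at N X) (\<lambda>a b. mod_act N X a (\<eta> X (mod_act M X (antipode H b) m))) h)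
      \<in> module_hom K (mod_at M X) (mod_at N X)"
    by (rule hom_sweedler[OF NX.module_V h MX.module_V])
      (rule NX.hom_act_right MX.hom_act_right module_hom_comp[OF rmod_hom_linear[OF \<eta> X]]
        module_hom_ident closed_intros | assumption)+
next
  fix X Y f m
  assume X: "X \<in> Obj C" and Y: "Y \<in> Obj C" and f: "f \<in> carrier (Hom C X Y)"
    and m: "m \<in> carrier (mod_at M Y)"
  interpret MX: left_H_module K H "mod_at M X" "mod_act M X" by (rule M.mod_H_module[OF X])
  interpret NX: left_H_module K H "mod_at N X" "mod_act N X" by (rule N.mod_H_module[OF X])
  interpret MY: left_H_module K H "mod_at M Y" "mod_act M Y" by (rule M.mod_H_module[OF Y])
  interpret XY: left_H_module K H "Hom C X Y" "act X Y" by (rule Hom_H_module[OF X Y])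
  let ?NX = "mod_at N X" and ?S = "antipode H"
  note cl = closed_intros f m XY.act_closed MY.act_closed M.map_closed[OF X Y]
  \<comment> \<open>Expanding the action of \<open>?S b\<close> by
    \<open>antipode_equivariant\<close> and moving \<open>\<eta>\<close> past the module maps gives
    exactly the left-hand side of \<open>sweedler_act_map\<close> for \<open>N\<close>.\<close>
  have "sweedler ?NX (\<lambda>a b. mod_act N X a (\<eta> X (mod_act M X (?S b) (mod_map M X Y f m)))) h =
      sweedler ?NX (\<lambda>a b. mod_act N X a (sweedler ?NX (\<lambda>c d.
        mod_map N X Y (act X Y (?S c) f) (\<eta> Y (mod_act M Y (?S d) m))) b)) h"
  proof (rule sweedler_cong[OF h])
    fix a b assume b: "b \<in> carrier H"
    have "\<eta> X (mod_act M X (?S b) (mod_map M X Y f m)) =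
        sweedler ?NX (\<lambda>c d. \<eta> X (mod_map M X Y (act X Y (?S c) f) (mod_act M Y (?S d) m))) b"
      unfolding M.antipode_equivariant[OF X Y b f m]
      by (rule sweedler_module_hom[OF MX.module_V NX.module_V rmod_hom_linear[OF \<eta> X] b])
        (intro cl)
    also have "\<dots> = sweedler ?NX (\<lambda>c d.
        mod_map N X Y (act X Y (?S c) f) (\<eta> Y (mod_act M Y (?S d) m))) b"
      by (rule sweedler_cong[OF b], rule rmod_hom_natural[OF \<eta> X Y]) (intro cl | assumption)+
    finally show "mod_act N X a (\<eta> X (mod_act M X (?S b) (mod_map M X Y f m))) =
      mod_act N X a (sweedler ?NX (\<lambda>c d.
        mod_map N X Y (act X Y (?S c) f) (\<eta> Y (mod_act M Y (?S d) m))) b)" by (rule arg_cong)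
  qed
  also have "\<dots> = mod_map N X Y f (sweedler (mod_at N Y)
      (\<lambda>a b. mod_act N Y a (\<eta> Y (mod_act M Y (?S b) m))) h)"
    by (rule N.sweedler_act_map[OF X Y h f])
      (rule module_hom_comp[OF rmod_hom_linear[OF \<eta> Y]] MY.hom_act_left hom_intros m)+
  finally show "sweedler ?NX (\<lambda>a b. mod_act N X a (\<eta> X (mod_act M X (?S b) (mod_map M X Y f m)))) h =
    mod_map N X Y f (sweedler (mod_at N Y) (\<lambda>a b. mod_act N Y a (\<eta> Y (mod_act M Y (?S b) m))) h)" .
qed

lemma left_H_module_rmod_hom: "left_H_module K H (rmod_hom K C M N) (rmod_hom_act H C M N)"
proof -
  let ?R = "rmod_hom K C M N" and ?act = "rmod_hom_act H C M N" and ?S = "antipode H"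
  have "?act \<in> bilinear_maps K H ?R ?R"
  proof (rule bilinear_mapsI)
    fix \<eta> assume \<eta>: "\<eta> \<in> carrier ?R"
    show "(\<lambda>h. ?act h \<eta>) \<in> module_hom K H ?R"
    proof (rule hom_rmod_homI[OF module_H])
      fix X m assume X: "X \<in> Obj C" and m: "m \<in> carrier (mod_at M X)"
      interpret MX: left_H_module K H "mod_at M X" "mod_act M X" by (rule M.mod_H_module[OF X])
      interpret NX: left_H_module K H "mod_at N X" "mod_act N X" by (rule N.mod_H_module[OF X])
      \<comment> \<open>Here the comultiplied element varies, so the summand must be bilinear in the
        two legs. Linearity in \<open>\<eta>\<close>, with \<open>h\<close> fixed, holds term by
        term.\<close>
      show "(\<lambda>h. ?act h \<eta> X m) \<in> module_hom K H (mod_at N X)"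
        unfolding rmod_hom_act_apply[OF X m]
        by (rule hom_sweedler_arg[OF NX.module_V _ module_hom_ident], rule bilinear_mapsI)
          (rule NX.hom_act_right NX.hom_act_left module_hom_comp[OF rmod_hom_linear[OF \<eta> X]]
            MX.hom_act_left hom_intros closed_intros rmod_hom_closed[OF \<eta> X] MX.act_closed m
            | assumption)+
    qed (rule rmod_hom_act_closed[OF _ \<eta>])
  next
    fix h assume h: "h \<in> carrier H"
    show "?act h \<in> module_hom K ?R ?R"
    proof (rule hom_rmod_homI[OF module_rmod_hom])
      fix X m assume X: "X \<in> Obj C" and m: "m \<in> carrier (mod_at M X)"
      interpret MX: left_H_module K H "mod_at M X" "mod_act M X" by (rule M.mod_H_module[OF X])
      interpret NX: left_H_module K H "mod_at N X" "mod_act N X" by (rule N.mod_H_module[OF X])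
      show "(\<lambda>\<eta>. ?act h \<eta> X m) \<in> module_hom K ?R (mod_at N X)"
        unfolding rmod_hom_act_apply[OF X m]
        by (rule hom_sweedler[OF NX.module_V h module_rmod_hom], rule NX.hom_act_right)
          (rule hom_eval[OF module_hom_ident X] MX.act_closed closed_intros m | assumption)+
    qed (rule rmod_hom_act_closed[OF h])
  qed
  moreover have "?act \<one>\<^bsub>H\<^esub> \<eta> = \<eta>" if \<eta>: "\<eta> \<in> carrier ?R" for \<eta>
  proof (rule eqI[OF rmod_hom_act_closed[OF H.one_closed \<eta>] \<eta>])
    fix X m assume X: "X \<in> Obj C" and m: "m \<in> carrier (mod_at M X)"
    interpret MX: left_H_module K H "mod_at M X" "mod_act M X" by (rule M.mod_H_module[OF X])
    interpret NX: left_H_module K H "mod_at N X" "mod_act N X" by (rule N.mod_H_module[OF X])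
    have "?act \<one>\<^bsub>H\<^esub> \<eta> X m = mod_act N X \<one>\<^bsub>H\<^esub> (\<eta> X (mod_act M X (?S \<one>\<^bsub>H\<^esub>) m))"
      unfolding rmod_hom_act_apply[OF X m]
      by (rule sweedler_one[OF NX.module_V], rule bilinear_mapsI)
        (rule NX.hom_act_right NX.hom_act_left module_hom_comp[OF rmod_hom_linear[OF \<eta> X]]
          MX.hom_act_left hom_intros closed_intros rmod_hom_closed[OF \<eta> X] MX.act_closed m
          | assumption)+
    then show "?act \<one>\<^bsub>H\<^esub> \<eta> X m = \<eta> X m"
      by (simp add: antipode_one MX.act_one NX.act_one m rmod_hom_closed[OF \<eta> X])
  qed
  moreover have "?act (g \<otimes>\<^bsub>H\<^esub> h) \<eta> = ?act g (?act h \<eta>)"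
    if g: "g \<in> carrier H" and h: "h \<in> carrier H" and \<eta>: "\<eta> \<in> carrier ?R" for g h \<eta>
  proof (rule eqI)
    show "?act (g \<otimes>\<^bsub>H\<^esub> h) \<eta> \<in> carrier ?R"
      by (rule rmod_hom_act_closed[OF mult_closed[OF g h] \<eta>])
    show "?act g (?act h \<eta>) \<in> carrier ?R"
      by (rule rmod_hom_act_closed[OF g rmod_hom_act_closed[OF h \<eta>]])
    fix X m assume X: "X \<in> Obj C" and m: "m \<in> carrier (mod_at M X)"
    interpret MX: left_H_module K H "mod_at M X" "mod_act M X" by (rule M.mod_H_module[OF X])
    interpret NX: left_H_module K H "mod_at N X" "mod_act N X" by (rule N.mod_H_module[OF X])
    let ?NX = "mod_at N X"
    note cl = closed_intros MX.act_closed NX.act_closed rmod_hom_closed[OF \<eta> X] m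
    note hom = NX.hom_act_right NX.hom_act_left module_hom_comp[OF rmod_hom_linear[OF \<eta> X]]
      MX.hom_act_left hom_intros
    have "?act (g \<otimes>\<^bsub>H\<^esub> h) \<eta> X m = sweedler ?NX (\<lambda>a b. sweedler ?NX (\<lambda>c d.
        mod_act N X (a \<otimes>\<^bsub>H\<^esub> c) (\<eta> X (mod_act M X (?S (b \<otimes>\<^bsub>H\<^esub> d)) m))) h) g"
      unfolding rmod_hom_act_apply[OF X m]
      by (rule sweedler_mult[OF NX.module_V _ g h], rule bilinear_mapsI) (rule hom cl | assumption)+
    also have "\<dots> = sweedler ?NX (\<lambda>a b. mod_act N X a (?act h \<eta> X (mod_act M X (?S b) m))) g"
    proof (rule sweedler_cong[OF g])
      fix a b assume a: "a \<in> carrier H" and b: "b \<in> carrier H"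
      let ?m = "mod_act M X (?S b) m"
      have m': "?m \<in> carrier (mod_at M X)" by (intro cl b)
      \<comment> \<open>Since \<open>S(b d) = S(d) S(b)\<close>, the factor \<open>S(b)\<close>
        reaches \<open>m\<close> first, and \<open>?m\<close> does not depend on \<open>d\<close>;
        what remains is the action of \<open>h\<close> evaluated at \<open>?m\<close>.\<close>
      have "sweedler ?NX (\<lambda>c d.
            mod_act N X (a \<otimes>\<^bsub>H\<^esub> c) (\<eta> X (mod_act M X (?S (b \<otimes>\<^bsub>H\<^esub> d)) m))) h =
          sweedler ?NX (\<lambda>c d. mod_act N X a (mod_act N X c (\<eta> X (mod_act M X (?S d) ?m)))) h"
        by (rule sweedler_cong[OF h]) (simp add: antipode_mult NX.act_mult MX.act_mult cl a b)
      also have "\<dots> = mod_act N X a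
          (sweedler ?NX (\<lambda>c d. mod_act N X c (\<eta> X (mod_act M X (?S d) ?m))) h)"
        by (rule sweedler_module_hom[OF NX.module_V NX.module_V _ h, symmetric])
          (rule NX.hom_act_right hom cl a b | assumption)+
      finally show "sweedler ?NX (\<lambda>c d.
          mod_act N X (a \<otimes>\<^bsub>H\<^esub> c) (\<eta> X (mod_act M X (?S (b \<otimes>\<^bsub>H\<^esub> d)) m))) h =
        mod_act N X a (?act h \<eta> X ?m)"
        by (simp only: rmod_hom_act_apply[OF X m'])
    qed
    finally show "?act (g \<otimes>\<^bsub>H\<^esub> h) \<eta> X m = ?act g (?act h \<eta>) X m"
      unfolding rmod_hom_act_apply[OF X m, where h = g] .
  qed
  ultimately show ?thesis
    by (intro left_H_module.intro left_H_module_axioms.intro hopf_algebra_axioms vectorspace_rmod_hom)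
qed

end

section \<open>The category of equivariant modules\<close>

lemma equivariant_modules_sel [simp]:
  "Obj (equivariant_modules K H C act) = {M. equivariant_right_module K H C act M}"
  "Hom (equivariant_modules K H C act) = rmod_hom K C"
  "Comp (equivariant_modules K H C act) L M N \<eta> \<theta> = nat_family C L (\<lambda>X m. \<eta> X (\<theta> X m))"
  "Id (equivariant_modules K H C act) M = nat_family C M (\<lambda>X m. m)"
  by (simp_all add: equivariant_modules_def)

lemma equivariant_pairI:
  "equivariant_right_module K H C act M \<Longrightarrow> equivariant_right_module K H C act N \<Longrightarrow>
    equivariant_pair K H C act M N"
  by (intro equivariant_pair.intro equivariant_right_module.axioms(1))

lemma comp_closed:
  assumes "equivariant_right_module K H C act L"
    and \<eta>: "\<eta> \<in> carrier (rmod_hom K C M N)" and \<theta>: "\<theta> \<in> carrier (rmod_hom K C L M)"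
  shows "nat_family C L (\<lambda>X m. \<eta> X (\<theta> X m)) \<in> carrier (rmod_hom K C L N)"
proof -
  interpret L: equivariant_right_module K H C act L by fact
  show ?thesis
    by (rule L.nat_family_in_rmod_hom)
      (simp_all add: module_hom_comp[OF rmod_hom_linear[OF \<eta>] rmod_hom_linear[OF \<theta>]]
        rmod_hom_natural[OF \<eta>] rmod_hom_natural[OF \<theta>] rmod_hom_closed[OF \<theta>])
qed

lemma id_closed:
  assumes "equivariant_right_module K H C act M"
  shows "nat_family C M (\<lambda>X m. m) \<in> carrier (rmod_hom K C M M)"
proof -
  interpret M: equivariant_right_module K H C act M by fact
  show ?thesis
    by (rule M.nat_family_in_rmod_hom) (simp_all add: module_hom_ident)
qed

text \<open>Composition is pointwise: linearity in the outer morphism is linearity of evaluation,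
  and linearity in the inner one is linearity of the components of the outer.\<close>

lemma linear_category_equivariant_modules:
  fixes K :: "('k, 'z) ring_scheme" and H :: "('k, 'h) hopf" and C :: "('o, 'm, 'k) lincat"
  assumes "field K"
  shows "linear_category K
    (equivariant_modules K H C act :: (('o, 'm, 'k, 'v, 'h) eqrmod, 'o \<Rightarrow> 'v \<Rightarrow> 'v, 'k) lincat)"
proof (intro linear_category.intro linear_category_axioms.intro assms, goal_cases)
  case (1 M N)
  interpret MN: equivariant_pair K H C act M N
    using 1 by (intro equivariant_pairI) simp_all
  show ?case by (simp add: MN.vectorspace_rmod_hom)
next
  case (2 L M N)
  interpret LM: equivariant_pair K H C act L M using 2 by (intro equivariant_pairI) simp_all
  interpret MN: equivariant_pair K H C act M N using 2 by (intro equivariant_pairI) simp_all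
  interpret LN: equivariant_pair K H C act L N using 2 by (intro equivariant_pairI) simp_all
  note cl = comp_closed[OF LM.M.equivariant_right_module_axioms]
  show ?case
    unfolding equivariant_modules_sel
  proof (rule bilinear_mapsI)
    fix \<theta> assume \<theta>: "\<theta> \<in> carrier (rmod_hom K C L M)"
    show "(\<lambda>\<eta>. nat_family C L (\<lambda>X m. \<eta> X (\<theta> X m))) \<in> module_hom K (rmod_hom K C M N) (rmod_hom K C L N)"
      by (rule LN.hom_rmod_homI[OF MN.module_rmod_hom])
        (simp_all add: cl[OF _ \<theta>] MN.hom_eval[OF module_hom_ident] rmod_hom_closed[OF \<theta>])
  next
    fix \<eta> assume \<eta>: "\<eta> \<in> carrier (rmod_hom K C M N)"
    show "(\<lambda>\<theta>. nat_family C L (\<lambda>X m. \<eta> X (\<theta> X m))) \<in> module_hom K (rmod_hom K C L M) (rmod_hom K C L N)"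
      by (rule LN.hom_rmod_homI[OF LM.module_rmod_hom])
        (simp_all add: cl[OF \<eta>] module_hom_comp[OF rmod_hom_linear[OF \<eta>] LM.hom_eval[OF module_hom_ident]])
  qed
next
  case (3 W X Y Z f g h)
  note obj = 3(1-4)[simplified] and f = 3(5)[simplified] and g = 3(6)[simplified]
    and h = 3(7)[simplified]
  show ?case
    unfolding equivariant_modules_sel
    by (rule rmod_hom_eqI[OF comp_closed[OF obj(1) comp_closed[OF obj(2) f g] h]
          comp_closed[OF obj(1) f comp_closed[OF obj(1) g h]]])
      (simp add: rmod_hom_closed[OF h])
next
  case (4 M)
  then show ?case by (simp add: id_closed)
next
  case (5 M N f)
  note obj = 5(1,2)[simplified] and f = 5(3)[simplified]
  show ?case
    unfolding equivariant_modules_sel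
    by (rule rmod_hom_eqI[OF comp_closed[OF obj(1) id_closed[OF obj(2)] f] f])
      (simp add: rmod_hom_closed[OF f])
next
  case (6 M N f)
  note obj = 6(1,2)[simplified] and f = 6(3)[simplified]
  show ?case
    unfolding equivariant_modules_sel
    by (rule rmod_hom_eqI[OF comp_closed[OF obj(1) f id_closed[OF obj(1)]] f])
      (simp add: rmod_hom_closed[OF f])
qed

section \<open>Compatibility of the action with identities and composition\<close>

lemma rmod_hom_act_id:
  assumes "equivariant_right_module K H C act M" and h: "h \<in> carrier H"
  shows "rmod_hom_act H C M M h (nat_family C M (\<lambda>X m. m)) =
    counit H h \<odot>\<^bsub>rmod_hom K C M M\<^esub> nat_family C M (\<lambda>X m. m)"
proof -
  interpret MM: equivariant_pair K H C act M M by (intro equivariant_pairI assms(1))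
  note id = id_closed[OF assms(1)]
  show ?thesis
  proof (rule MM.eqI[OF MM.rmod_hom_act_closed[OF h id] MM.rmod_hom_smult_closed[OF id MM.counit_closed[OF h]]])
    fix X m assume X: "X \<in> Obj C" and m: "m \<in> carrier (mod_at M X)"
    interpret MX: left_H_module K H "mod_at M X" "mod_act M X" by (rule MM.M.mod_H_module[OF X])
    have "rmod_hom_act H C M M h (nat_family C M (\<lambda>X m. m)) X m =
        MM.sweedler (mod_at M X) (\<lambda>a b. mod_act M X a (mod_act M X (antipode H b) m)) h"
      unfolding rmod_hom_act_apply[OF X m]
      by (rule MM.sweedler_cong[OF h]) (simp add: X m MX.act_closed MM.antipode_closed)
    then show "rmod_hom_act H C M M h (nat_family C M (\<lambda>X m. m)) X m =
        (counit H h \<odot>\<^bsub>rmod_hom K C M M\<^esub> nat_family C M (\<lambda>X m. m)) X m"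
      by (simp add: X m h MX.act_antipode_right)
  qed
qed

text \<open>The calculation runs from the composite of the two actions, which has four legs, to the
  action on the composite, which has two.\<close>

lemma rmod_hom_act_comp:
  assumes L: "equivariant_right_module K H C act L" and M: "equivariant_right_module K H C act M"
    and N: "equivariant_right_module K H C act N" and h: "h \<in> carrier H"
    and \<eta>: "\<eta> \<in> carrier (rmod_hom K C M N)" and \<theta>: "\<theta> \<in> carrier (rmod_hom K C L M)"
  shows "rmod_hom_act H C L N h (nat_family C L (\<lambda>X m. \<eta> X (\<theta> X m))) =
    tensor_lift (rmod_hom K C L N) (\<lambda>a b. nat_family C L (\<lambda>X m.
      rmod_hom_act H C M N a \<eta> X (rmod_hom_act H C L M b \<theta> X m))) (comult H h)"
proof -
  interpret LM: equivariant_pair K H C act L M by (intro equivariant_pairI L M)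
  interpret MN: equivariant_pair K H C act M N by (intro equivariant_pairI M N)
  interpret LN: equivariant_pair K H C act L N by (intro equivariant_pairI L N)
  let ?S = "antipode H" and ?R = "rmod_hom K C L N"
  let ?c = "\<lambda>a b. nat_family C L (\<lambda>X m.
    rmod_hom_act H C M N a \<eta> X (rmod_hom_act H C L M b \<theta> X m))"
  note closed = comp_closed[OF L \<eta> \<theta>]
  have ccl: "?c a b \<in> carrier ?R" if "a \<in> carrier H" "b \<in> carrier H" for a b
    by (rule comp_closed[OF L MN.rmod_hom_act_closed[OF that(1) \<eta>] LM.rmod_hom_act_closed[OF that(2) \<theta>]])
  show ?thesis
  proof (rule LN.eqI)
    show "rmod_hom_act H C L N h (nat_family C L (\<lambda>X m. \<eta> X (\<theta> X m))) \<in> carrier ?R"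
      by (rule LN.rmod_hom_act_closed[OF h closed])
    show "LM.sweedler ?R ?c h \<in> carrier ?R"
      by (rule LM.sweedler_closed[OF LN.module_rmod_hom h ccl])
    fix X m assume X: "X \<in> Obj C" and m: "m \<in> carrier (mod_at L X)"
    interpret LX: left_H_module K H "mod_at L X" "mod_act L X" by (rule LM.M.mod_H_module[OF X])
    interpret MX: left_H_module K H "mod_at M X" "mod_act M X" by (rule LM.N.mod_H_module[OF X])
    interpret NX: left_H_module K H "mod_at N X" "mod_act N X" by (rule MN.N.mod_H_module[OF X])
    let ?NX = "mod_at N X" and ?MX = "mod_at M X"
    note cl = LM.closed_intros LX.act_closed MX.act_closed NX.act_closed rmod_hom_closed[OF \<eta> X]
      rmod_hom_closed[OF \<theta> X] m
    note hom = NX.hom_act_right NX.hom_act_left module_hom_comp[OF rmod_hom_linear[OF \<eta> X]]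
      MX.hom_act_right MX.hom_act_left module_hom_comp[OF rmod_hom_linear[OF \<theta> X]]
      LX.hom_act_left LM.hom_intros
    \<comment> \<open>The sum is formed in the space of morphisms; evaluation at \<open>m\<close> is
      linear and moves inside.\<close>
    have "LM.sweedler ?R ?c h X m = LM.sweedler ?NX (\<lambda>a b. ?c a b X m) h"
      by (rule LM.sweedler_module_hom[OF LN.module_rmod_hom NX.module_V _ h ccl])
        (rule LN.hom_eval[OF module_hom_ident X m])
    also have "\<dots> = LM.sweedler ?NX (\<lambda>a b. LM.sweedler ?NX (\<lambda>c d. LM.sweedler ?NX (\<lambda>e f.
        mod_act N X e (\<eta> X (mod_act M X (?S f \<otimes>\<^bsub>H\<^esub> c) (\<theta> X (mod_act L X (?S d) m))))) a) b) h"
    proof (rule LM.sweedler_cong[OF h])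
      fix a b assume a: "a \<in> carrier H" and b: "b \<in> carrier H"
      let ?m = "LM.sweedler ?MX (\<lambda>c d. mod_act M X c (\<theta> X (mod_act L X (?S d) m))) b"
      have m': "?m \<in> carrier ?MX"
        by (rule LM.sweedler_closed[OF MX.module_V b]) (intro cl)
      have lin: "rmod_hom_act H C M N a \<eta> X \<in> module_hom K ?MX ?NX"
        by (rule rmod_hom_linear[OF MN.rmod_hom_act_closed[OF a \<eta>] X])
      have "?c a b X m = rmod_hom_act H C M N a \<eta> X ?m"
        by (simp add: X m)
      \<comment> \<open>The result of \<open>a\<close> acting on \<open>\<eta>\<close> is again a
        morphism, hence linear, and passes under the sum over \<open>b\<close>.\<close>
      also have "\<dots> = LM.sweedler ?NX (\<lambda>c d. rmod_hom_act H C M N a \<eta> X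
          (mod_act M X c (\<theta> X (mod_act L X (?S d) m)))) b"
        by (rule LM.sweedler_module_hom[OF MX.module_V NX.module_V lin b]) (intro cl)
      also have "\<dots> = LM.sweedler ?NX (\<lambda>c d. LM.sweedler ?NX (\<lambda>e f.
        mod_act N X e (\<eta> X (mod_act M X (?S f \<otimes>\<^bsub>H\<^esub> c) (\<theta> X (mod_act L X (?S d) m))))) a) b"
      proof (rule LM.sweedler_cong[OF b])
        fix c d assume c: "c \<in> carrier H" and d: "d \<in> carrier H"
        have v: "mod_act M X c (\<theta> X (mod_act L X (?S d) m)) \<in> carrier ?MX" by (intro cl c d)
        show "rmod_hom_act H C M N a \<eta> X (mod_act M X c (\<theta> X (mod_act L X (?S d) m))) =
          LM.sweedler ?NX (\<lambda>e f. mod_act N X e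
            (\<eta> X (mod_act M X (?S f \<otimes>\<^bsub>H\<^esub> c) (\<theta> X (mod_act L X (?S d) m))))) a"
          unfolding rmod_hom_act_apply[OF X v]
          by (rule LM.sweedler_cong[OF a]) (simp add: MX.act_mult cl c d)
      qed
      finally show "?c a b X m = LM.sweedler ?NX (\<lambda>c d. LM.sweedler ?NX (\<lambda>e f.
        mod_act N X e (\<eta> X (mod_act M X (?S f \<otimes>\<^bsub>H\<^esub> c) (\<theta> X (mod_act L X (?S d) m))))) a) b" .
    qed
    \<comment> \<open>The legs in order are \<open>e\<close>, \<open>f\<close>, \<open>c\<close>,
      \<open>d\<close>. The middle two meet between \<open>\<eta>\<close> and
      \<open>\<theta>\<close> as \<open>S(f) c\<close>, the product cancelled by the left antipode
      axiom.\<close>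
    also have "\<dots> = LM.sweedler ?NX (\<lambda>e d.
        mod_act N X e (\<eta> X (mod_act M X \<one>\<^bsub>H\<^esub> (\<theta> X (mod_act L X (?S d) m))))) h"
      by (rule LM.sweedler_cancel_left[OF NX.module_V _ h, where G =
            "\<lambda>e v d. mod_act N X e (\<eta> X (mod_act M X v (\<theta> X (mod_act L X (?S d) m))))"])
        (rule LM.trilinearI; (rule hom cl | assumption)+)
    also have "\<dots> = LM.sweedler ?NX (\<lambda>e d.
        mod_act N X e (nat_family C L (\<lambda>X m. \<eta> X (\<theta> X m)) X (mod_act L X (?S d) m))) h"
      by (rule LM.sweedler_cong[OF h]) (simp add: X MX.act_one cl)
    also have "\<dots> = rmod_hom_act H C L N h (nat_family C L (\<lambda>X m. \<eta> X (\<theta> X m))) X m"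
      by (simp only: rmod_hom_act_apply[OF X m])
    finally show "rmod_hom_act H C L N h (nat_family C L (\<lambda>X m. \<eta> X (\<theta> X m))) X m =
      LM.sweedler ?R ?c h X m" ..
  qed
qed

theorem lemma3p3:
  fixes K :: "('k, 'z) ring_scheme"
    and H :: "('k, 'h) hopf"
    and C :: "('o, 'm, 'k) lincat"
    and act :: "'o \<Rightarrow> 'o \<Rightarrow> 'h \<Rightarrow> 'm \<Rightarrow> 'm"
  assumes "field K"
    and "hopf_algebra K H"
    and "bij_betw (antipode H) (carrier H) (carrier H)"
    and "left_H_category K H C act"
  shows "left_H_module_category K H
    (equivariant_modules K H C act :: (('o, 'm, 'k, 'v, 'h) eqrmod, 'o \<Rightarrow> 'v \<Rightarrow> 'v, 'k) lincat)
    (rmod_hom_act H C)"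
proof (intro left_H_module_category.intro left_H_module_category_axioms.intro assms(2)
    linear_category_equivariant_modules assms(1), goal_cases)
  case (1 M N)
  then show ?case
    unfolding equivariant_modules_sel mem_Collect_eq
    by (intro equivariant_pair.left_H_module_rmod_hom equivariant_pairI)
next
  case (2 M h)
  then show ?case by (simp add: rmod_hom_act_id)
next
  case (3 L M N h \<eta> \<theta>)
  then show ?case by (simp add: rmod_hom_act_comp)
qed

end
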